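(* Let $\gamma>1$ and $K>0$ be fixed. Assume that $f\in C^2([0,\infty))$ satisfies $f(0)=0$, $f'(x)>0$ for all $x\ge0$, that $$2f(x)+\gamma K^2\big(2f(x)f'(x)^2+f(x)^2f''(x)\big)>0\quad\text{for all }x>0,$$ and that, for all sufficiently small $\tau>0$ and all $x\ge0$, $$f(x)(1+\tau^2f'(x)^2)^{3/2}+\gamma K^2\Big(f''(x)M_\tau(x)+\sqrt{1+\tau^2f'(x)^2}\,f(x)f'(x)^2\Big)\ge0,\qquad M_\tau(x)=\int_0^x\frac{f(t)f'(t)}{\sqrt{1+\tau^2f'(t)^2}}\,\mathrm{d}t.$$ Let $(\bar\varrho^{(\tau)},\bar u^{(\tau)},\bar v^{(\tau)},\bar w^{(\tau)},\bar E^{(\tau)})$ and $\bar w_p^{(\tau)}$ be the scaled axisymmetric Radon measure solution of Problem A$'$ and its scaled pressure coefficient, and let $(\bar\varrho,\bar u,\bar v,\bar w,\bar E)$ and $\bar w_p$ be the axisymmetric Radon measure solution of Problem B$'$ and its pressure coefficient (all given explicitly in the context). Set $\bar\mu=\mathcal{L}^3|_{\Omega'}+\delta_{\Gamma'}$, with $\delta_{\Gamma'}$ the surface measure of $\Gamma'$. Then, as $\tau\to0$ with $K$ and $\gamma$ fixed, pointwise on $\Omega'\cup\Gamma'$ (away from the vertex $(0,0,0)$), $$\bar u^{(\tau)}=\bar u+o(1),\quad \bar v^{(\tau)}=\bar v+o(1),\quad \bar w^{(\tau)}=\bar w+o(1),\quad \bar E^{(\tau)}=\bar E+o(1),\quad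 \frac{\mathrm{d}\bar\varrho^{(\tau)}}{\mathrm{d}\bar\mu}=\tau\frac{\mathrm{d}\bar\varrho}{\mathrm{d}\bar\mu}+o(\tau),$$ where the Radon–Nikodym derivatives are represented by their versions that are continuous on $\Omega'$ and on $\Gamma'$ separately, and $\bar w_p^{(\tau)}=\bar w_p+o(1)$ pointwise on $[0,\infty)$.
   Context: Notation: $m|_A$ is restriction of a measure to a Borel set; $\chi_A$ the indicator function; $\langle m,\phi\rangle=\int\phi\,\mathrm{d}m$; $\lambda\ll\mu$ is absolute continuity. On the half-plane $\mathbb{R}^2_+=\{(x,r):x\in\mathbb{R},r\ge0\}$ the axisymmetric Lebesgue measure is $\langle\mathcal{L}^2_{as},\phi\rangle=\int\phi(x,r)\,r\,\mathrm{d}x\mathrm{d}r$; for a curve $L=\{(x,g(x)):x\ge0\}$ and a weight $w$ the weighted circular Dirac measure is $\langle w\delta_{L},\phi\rangle=\int_0^\infty g(x)w(x)\phi(x,g(x))\sqrt{1+g'(x)^2}\,\mathrm{d}x$ (all Dirac measures on curves in the half-plane below are circular ones). A measure $\nu$ on $\mathbb{R}^2_+$ corresponds to the axisymmetric measure on $\mathbb{R}^3$ given by $\phi\mapsto\int_{-\pi}^{\pi}\langle\nu,\phi(x,r\cos\theta,r\sin\theta)\rangle\,\mathrm{d}\theta$; thus $\mathcal{L}^2_{as}$ corresponds to $\mathcal{L}^3$ and $\delta_L$ to surface measure. Parameters: $0<\tau<1$ is the slenderness ratio, $M_\infty>1$ the Mach number of the oncoming flow, $K=M_\infty\tau$ (kept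 fixed), $\rho_\infty,u_\infty>0$ constants, $E_\infty=\frac12u_\infty^2\big(1+\frac{2\tau^2}{(\gamma-1)K^2}\big)$, $p_\infty=\frac{\rho_\infty u_\infty^2\tau^2}{\gamma K^2}$, $\bar E_\infty=\frac2{(\gamma-1)K^2}$, $\bar p_\infty=\frac1{\gamma K^2}$. Domains: $\Omega=\{x\ge0,\ y^2+z^2>\tau^2f(x)^2\}$, $\Gamma=\{x\ge0,\ y^2+z^2=\tau^2f(x)^2\}$, $\Omega'=\{\bar x\ge0,\ \bar y^2+\bar z^2>f(\bar x)^2\}$, $\Gamma'=\{\bar x\ge0,\ \bar y^2+\bar z^2=f(\bar x)^2\}$; in cylindrical coordinates, $\Omega_{as}=\{x\ge0,\ r>\tau f(x)\}$, $\Gamma_{as}=\{x\ge0,\ r=\tau f(x)\}$ with unit normal $(n_1,n_2)=(-\tau f',1)/\sqrt{1+\tau^2f'^2}$; $\Omega'_{as}=\{\bar x\ge0,\ \bar r>f(\bar x)\}$, $\Gamma'_{as}=\{\bar x\ge0,\ \bar r=f(\bar x)\}$ with unit normal $(n_1',n_2')=(-f',1)/\sqrt{1+f'^2}$. Problem A$'$: steady three-dimensional non-isentropic compressible Euler flow in $\Omega$ (unknown density, velocity $(u,v,w)$, total enthalpy $E$, pressure $p=\frac{\gamma-1}{\gamma}\rho(E-\frac12(u^2+v^2+w^2))$) with oncoming flow $(\rho_\infty,u_\infty,0,0,E_\infty)$ at $x=0$ and slip condition (tangential flow) on $\Gamma$. An axisymmetric Radon measure solution is one with zero swirl, described in cylindrical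 coordinates by a tuple $(\varrho,u,q,E)$ ($u$ axial velocity, $q$ radial velocity; Cartesian velocity $(u,q\,y/r,q\,z/r)$, and $\varrho$ identified with its axisymmetric counterpart on $\mathbb{R}^3$) for which there are nonnegative Radon measures $\varrho,\wp,\wp'$ and signed Radon measures $m_a^j,m_b^j$ $(j=0,1,2,3)$ on $\overline{\Omega}_{as}$ and a nonnegative $w_p\in L^1_{loc}([0,\infty))$ such that: (i) for all $\phi\in C_c^1(\mathbb{R}^2_+)$: $\langle m_a^0,\partial_x\phi\rangle+\langle m_b^0,\partial_r\phi\rangle+\int_0^\infty r\rho_\infty u_\infty\phi(0,r)\mathrm{d}r=0$; $\langle m_a^1+\wp,\partial_x\phi\rangle+\langle m_b^1,\partial_r\phi\rangle+\langle w_pn_1\delta_{\Gamma_{as}},\phi\rangle+\int_0^\infty r(\rho_\infty u_\infty^2+p_\infty)\phi(0,r)\mathrm{d}r=0$; $\langle m_a^2,\partial_x\phi\rangle+\langle m_b^2+\wp,\partial_r\phi\rangle+\langle\wp',\phi\rangle+\langle w_pn_2\delta_{\Gamma_{as}},\phi\rangle=0$; $\langle m_a^3,\partial_x\phi\rangle+\langle m_b^3,\partial_r\phi\rangle+\int_0^\infty r\rho_\infty u_\infty E_\infty\phi(0,r)\mathrm{d}r=0$; (ii) $\wp,\wp',m_a^j,m_b^j\ll\varrho$, and $\varrho$-a.e. $u=\frac{\mathrm{d}m_a^0}{\mathrm{d}\varrho}$, $q=\frac{\mathrm{d}m_b^0}{\mathrm{d}\varrho}$, $u^2=\frac{\mathrm{d}m_a^1}{\mathrm{d}\varrho}$,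 $uq=\frac{\mathrm{d}m_b^1}{\mathrm{d}\varrho}=\frac{\mathrm{d}m_a^2}{\mathrm{d}\varrho}$, $q^2=\frac{\mathrm{d}m_b^2}{\mathrm{d}\varrho}$, $Eu=\frac{\mathrm{d}m_a^3}{\mathrm{d}\varrho}$, $Eq=\frac{\mathrm{d}m_b^3}{\mathrm{d}\varrho}$; (iii) if $\varrho,\wp,\wp'\ll\mathcal{L}^2_{as}$ with densities $\rho,p,p'$ near a point of $\Omega_{as}$, then there a.e. $p=p'=\frac{\gamma-1}{\gamma}\rho(E-\frac12(u^2+q^2))$, and the classical entropy condition holds at discontinuities of $\rho,u,q,E$. The axisymmetric Radon measure solution of Problem A$'$ considered is $u=u_\infty\chi_{\Omega_{as}}+\frac{2u_\infty M_\tau(x)}{f(x)^2\sqrt{1+\tau^2f'(x)^2}}\chi_{\Gamma_{as}}$, $q=\frac{2\tau u_\infty f'(x)M_\tau(x)}{f(x)^2\sqrt{1+\tau^2f'(x)^2}}\chi_{\Gamma_{as}}$, $\varrho=\rho_\infty\mathcal{L}^2_{as}|_{\Omega_{as}}+w_\rho(x)\delta_{\Gamma_{as}}$ with $w_\rho(x)=\frac{\tau\rho_\infty f(x)^3}{4M_\tau(x)}$, $E=E_\infty\chi_{\Omega_{as}}+E_\infty\chi_{\Gamma_{as}}$, with $w_p(x)=\rho_\infty u_\infty^2\tau^2\Big(\frac1{\gamma K^2}+\frac{f''(x)M_\tau(x)+\sqrt{1+\tau^2f'(x)^2}f(x)f'(x)^2}{f(x)(1+\tau^2f'(x)^2)^{3/2}}\Big)$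 (values at $x=0$ by continuity). Scaling: $\bar x=x$, $\bar y=y/\tau$, $\bar z=z/\tau$ (so $\bar r=r/\tau$, same angle), and at corresponding points $\bar u^{(\tau)}=\frac{u-u_\infty}{u_\infty\tau^2}$, $\bar v^{(\tau)}=\frac{q}{u_\infty\tau}\frac{\bar y}{\bar r}$, $\bar w^{(\tau)}=\frac{q}{u_\infty\tau}\frac{\bar z}{\bar r}$, $\bar E^{(\tau)}=\frac{2E-u_\infty^2}{u_\infty^2\tau^2}$; $\bar w_p^{(\tau)}=w_p/(\gamma p_\infty K^2)$. The scaled mass measure $\bar\varrho^{(\tau)}$ is the axisymmetric measure corresponding to the measure on the half-plane defined by $$\langle\bar\varrho^{(\tau)},\bar\phi\rangle=\tau\Big(\int_{\Omega'_{as}}\bar r\bar\phi\,\mathrm{d}\bar x\mathrm{d}\bar r+\int_0^\infty\frac{w_\rho(\bar x)}{\tau\rho_\infty}f(\bar x)\bar\phi(\bar x,f(\bar x))\sqrt{1+\tau^2f'(\bar x)^2}\,\mathrm{d}\bar x\Big).$$ Problem B$'$ (hypersonic small-disturbance problem): in $\Omega'$, $\partial_{\bar x}\bar\rho+\partial_{\bar y}(\bar\rho\bar v)+\partial_{\bar z}(\bar\rho\bar w)=0$, $\partial_{\bar x}(\bar\rho\bar u+\bar p)+\partial_{\bar y}(\bar\rho\bar u\bar v)+\partial_{\bar z}(\bar\rho\bar u\bar w)=0$, $\partial_{\bar x}(\bar\rho\bar v)+\partial_{\bar y}(\bar\rho\bar v^2+\bar p)+\partial_{\bar z}(\bar\rho\bar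 v\bar w)=0$, $\partial_{\bar x}(\bar\rho\bar w)+\partial_{\bar y}(\bar\rho\bar v\bar w)+\partial_{\bar z}(\bar\rho\bar w^2+\bar p)=0$, $\partial_{\bar x}(\bar\rho\bar E)+\partial_{\bar y}(\bar\rho\bar v\bar E)+\partial_{\bar z}(\bar\rho\bar w\bar E)=0$, $\bar p=\frac{\gamma-1}{2\gamma}\bar\rho(\bar E-2\bar u-\bar v^2-\bar w^2)$, with oncoming flow $(1,0,0,0,\bar E_\infty)$ at $\bar x=0$ and $f(\bar x)f'(\bar x)=\bar v\bar y+\bar w\bar z$ on $\Gamma'$. An axisymmetric Radon measure solution is described in cylindrical coordinates by a tuple $(\bar\varrho,\bar u,\bar q,\bar E)$ ($\bar q$ radial velocity; $\bar v=\bar q\,\bar y/\bar r$, $\bar w=\bar q\,\bar z/\bar r$) for which there are nonnegative Radon measures $\bar\varrho,\bar\wp,\bar\wp'$ and signed Radon measures $\bar m_a^j,\bar m_b^j$ $(j=0,1,2,3)$ on $\overline{\Omega'_{as}}$ with $\bar m_a^0=\bar\varrho$, and a nonnegative $\bar w_p\in L^1_{loc}([0,\infty))$ such that: (i) for all $\phi\in C_c^1(\mathbb{R}^2_+)$: $\langle\bar m_a^0,\partial_{\bar x}\phi\rangle+\langle\bar m_b^0,\partial_{\bar r}\phi\rangle+\int_0^\infty\bar r\phi(0,\bar r)\mathrm{d}\bar r=0$; $\langle\bar m_a^1+\bar\wp,\partial_{\bar x}\phi\rangle+\langle\bar m_b^1,\partial_{\bar r}\phi\rangle+\langle\bar w_pn_1'\delta_{\Gamma'_{as}},\phi\rangle+\int_0^\infty\bar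 r\bar p_\infty\phi(0,\bar r)\mathrm{d}\bar r=0$; $\langle\bar m_a^2,\partial_{\bar x}\phi\rangle+\langle\bar m_b^2+\bar\wp,\partial_{\bar r}\phi\rangle+\langle\bar\wp',\phi\rangle+\langle\bar w_pn_2'\delta_{\Gamma'_{as}},\phi\rangle=0$; $\langle\bar m_a^3,\partial_{\bar x}\phi\rangle+\langle\bar m_b^3,\partial_{\bar r}\phi\rangle+\int_0^\infty\bar r\bar E_\infty\phi(0,\bar r)\mathrm{d}\bar r=0$; (ii) $\bar\wp,\bar\wp',\bar m_a^j,\bar m_b^j\ll\bar\varrho$ and $\bar\varrho$-a.e. $\bar u=\frac{\mathrm{d}\bar m_a^1}{\mathrm{d}\bar\varrho}$, $\bar q=\frac{\mathrm{d}\bar m_b^0}{\mathrm{d}\bar\varrho}=\frac{\mathrm{d}\bar m_a^2}{\mathrm{d}\bar\varrho}$, $\bar u\bar q=\frac{\mathrm{d}\bar m_b^1}{\mathrm{d}\bar\varrho}$, $\bar q^2=\frac{\mathrm{d}\bar m_b^2}{\mathrm{d}\bar\varrho}$, $\bar E=\frac{\mathrm{d}\bar m_a^3}{\mathrm{d}\bar\varrho}$, $\bar E\bar q=\frac{\mathrm{d}\bar m_b^3}{\mathrm{d}\bar\varrho}$; (iii) if $\bar\varrho,\bar\wp,\bar\wp'\ll\mathcal{L}^2_{as}$ with densities $\bar\rho,\bar p,\bar p'$ near a point of $\Omega'_{as}$, then there a.e. $\bar p=\bar p'=\frac{\gamma-1}{2\gamma}\bar\rho(\bar E-2\bar u-\bar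 q^2)$, and the classical entropy condition holds at discontinuities. The axisymmetric Radon measure solution of Problem B$'$ considered is $\bar u=\Big(-f'(\bar x)^2+\frac{\int_0^{\bar x}f(t)^2f'(t)f''(t)\mathrm{d}t}{f(\bar x)^2}\Big)\chi_{\Gamma'_{as}}$, $\bar q=f'(\bar x)\chi_{\Gamma'_{as}}$, $\bar\varrho=\mathcal{L}^2_{as}|_{\Omega'_{as}}+\frac{f(\bar x)}{2\sqrt{1+f'(\bar x)^2}}\delta_{\Gamma'_{as}}$, $\bar E=\bar E_\infty\chi_{\Omega'_{as}}+\bar E_\infty\chi_{\Gamma'_{as}}$, with $\bar w_p(\bar x)=\bar p_\infty+f'(\bar x)^2+\frac12f(\bar x)f''(\bar x)$. *)

theory Defs
  imports "HOL-Analysis.Analysis" "HOL-Library.Landau_Symbols"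
begin

text \<open>
  A body of revolution is given by its generatrix \<open>g\<close> on \<open>[0, \<infinity>)\<close>: the profile \<open>\<lambda>x. \<tau> * f x\<close> of the
  slender body, or \<open>f\<close> itself after scaling. The half-plane of pairs \<open>(x, r)\<close> with \<open>r \<ge> 0\<close> is
  embedded in \<open>real \<times> real\<close>; all measures on it below are carried by \<open>r \<ge> 0\<close>. Functions on
  \<open>[0, \<infinity>)\<close> are total functions whose values at negative arguments are irrelevant, and \<open>f'\<close>, \<open>f''\<close>
  stand for the (at \<open>0\<close> one-sided) derivatives of \<open>f\<close>.

  Names with \<open>A\<close> refer to the axisymmetric measure solution for the Euler flow past the slender
  body (in physical variables), names with \<open>scaled\<close> to its rescaling, and names with \<open>B\<close> to the
  solution of the hypersonic small-disturbance problem.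
\<close>

definition Omega_as :: "(real \<Rightarrow> real) \<Rightarrow> (real \<times> real) set" where
  "Omega_as g = {(x, r). 0 \<le> x \<and> g x < r}"

definition Gamma_as :: "(real \<Rightarrow> real) \<Rightarrow> (real \<times> real) set" where
  "Gamma_as g = {(x, r). 0 \<le> x \<and> r = g x}"

definition Omega3 :: "(real \<Rightarrow> real) \<Rightarrow> (real \<times> real \<times> real) set" where
  "Omega3 g = {(x, y, z). 0 \<le> x \<and> (g x)\<^sup>2 < y\<^sup>2 + z\<^sup>2}"

definition Gamma3 :: "(real \<Rightarrow> real) \<Rightarrow> (real \<times> real \<times> real) set" where
  "Gamma3 g = {(x, y, z). 0 \<le> x \<and> y\<^sup>2 + z\<^sup>2 = (g x)\<^sup>2}"

definition plus_measure :: "'a measure \<Rightarrow> 'a measure \<Rightarrow> 'a measure" where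
  "plus_measure M N = measure_of (space M) (sets M) (\<lambda>A. emeasure M A + emeasure N A)"

text \<open>Restriction to a Borel set as a measure on the whole space (unlike \<^const>\<open>restrict_space\<close>).\<close>

definition restr_measure :: "'a measure \<Rightarrow> 'a set \<Rightarrow> 'a measure" where
  "restr_measure M A = density M (indicator A)"

text \<open>The factor \<open>ennreal r\<close> vanishes for \<open>r \<le> 0\<close>.\<close>

definition L2_as :: "(real \<times> real) measure" where
  "L2_as = density lborel (\<lambda>(x, r). ennreal r)"

text \<open>The image of \<open>a(x) dx\<close> on \<open>[0, \<infinity>)\<close> under \<open>x \<mapsto> (x, g x)\<close>.\<close>

definition curve_measure :: "(real \<Rightarrow> real) \<Rightarrow> (real \<Rightarrow> real) \<Rightarrow> (real \<times> real) measure" where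
  "curve_measure g a =
     distr (density (restrict_space lborel {0..}) (\<lambda>x. ennreal (a x))) borel (\<lambda>x. (x, g x))"

definition circ_dirac :: "(real \<Rightarrow> real) \<Rightarrow> (real \<Rightarrow> real) \<Rightarrow> (real \<Rightarrow> real) \<Rightarrow> (real \<times> real) measure" where
  "circ_dirac g g' w = curve_measure g (\<lambda>x. g x * w x * sqrt (1 + (g' x)\<^sup>2))"

text \<open>
  The axisymmetric measure on \<open>\<real>\<^sup>3\<close> corresponding to a measure on the half-plane, i.e.
  \<open>\<phi> \<mapsto> \<integral> \<langle>\<nu>, \<phi>(x, r cos \<theta>, r sin \<theta>)\<rangle> d\<theta>\<close> over \<open>[-\<pi>, \<pi>]\<close>.
\<close>

definition axisym :: "(real \<times> real) measure \<Rightarrow> (real \<times> real \<times> real) measure" where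
  "axisym \<nu> = distr (\<nu> \<Otimes>\<^sub>M restrict_space lborel {-pi..pi}) borel
                 (\<lambda>((x, r), \<theta>). (x, r * cos \<theta>, r * sin \<theta>))"

text \<open>
  The area of the parallelogram spanned by two vectors, and the surface measure of a surface
  parametrised by \<open>X\<close> over \<open>D\<close>, with partial derivatives \<open>Xs\<close> and \<open>Xt\<close>.
\<close>

definition area_element :: "'a::real_inner \<Rightarrow> 'a \<Rightarrow> real" where
  "area_element a b = sqrt ((norm a)\<^sup>2 * (norm b)\<^sup>2 - (a \<bullet> b)\<^sup>2)"

definition surface_measure ::
  "(real \<times> real) set \<Rightarrow> (real \<times> real \<Rightarrow> 'a::euclidean_space) \<Rightarrow> (real \<times> real \<Rightarrow> 'a) \<Rightarrow> (real \<times> real \<Rightarrow> 'a) \<Rightarrow> 'a measure"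
where
  "surface_measure D X Xs Xt =
     distr (density (restrict_space lborel D) (\<lambda>p. ennreal (area_element (Xs p) (Xt p)))) borel X"

text \<open>The circles \<open>\<theta> = \<plusminus>\<pi>\<close> are identified, but they form a null set of parameters.\<close>

definition surface_Gamma3 :: "(real \<Rightarrow> real) \<Rightarrow> (real \<Rightarrow> real) \<Rightarrow> (real \<times> real \<times> real) measure" where
  "surface_Gamma3 g g' =
     surface_measure ({0..} \<times> {-pi..pi})
       (\<lambda>(s, \<theta>). (s, g s * cos \<theta>, g s * sin \<theta>))
       (\<lambda>(s, \<theta>). (1, g' s * cos \<theta>, g' s * sin \<theta>))
       (\<lambda>(s, \<theta>). (0, - g s * sin \<theta>, g s * cos \<theta>))"

definition mu_bar :: "(real \<Rightarrow> real) \<Rightarrow> (real \<Rightarrow> real) \<Rightarrow> (real \<times> real \<times> real) measure" where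
  "mu_bar f f' = plus_measure (restr_measure lborel (Omega3 f)) (surface_Gamma3 f f')"

text \<open>
  \<open>h\<close> is a finite nonnegative version of the Radon--Nikodym derivative of \<open>\<nu>\<close> with respect to \<open>\<mu>\<close>
  that is continuous on \<open>A\<close> and on \<open>B\<close> separately. Absolute continuity has to be required, since
  \<^const>\<open>RN_deriv\<close> is \<open>0\<close> when there is no density.
\<close>

definition RN_version ::
  "'a::topological_space measure \<Rightarrow> 'a measure \<Rightarrow> 'a set \<Rightarrow> 'a set \<Rightarrow> ('a \<Rightarrow> real) \<Rightarrow> bool"
where
  "RN_version \<mu> \<nu> A B h \<longleftrightarrow>
     sets \<nu> = sets \<mu> \<and> absolutely_continuous \<mu> \<nu> \<and>
     h \<in> borel_measurable \<mu> \<and> (\<forall>p. 0 \<le> h p) \<and>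
     (AE p in \<mu>. RN_deriv \<mu> \<nu> p = ennreal (h p)) \<and>
     continuous_on A h \<and> continuous_on B h"

definition M_tau :: "real \<Rightarrow> (real \<Rightarrow> real) \<Rightarrow> (real \<Rightarrow> real) \<Rightarrow> real \<Rightarrow> real" where
  "M_tau \<tau> f f' x = integral {0..x} (\<lambda>t. f t * f' t / sqrt (1 + \<tau>\<^sup>2 * (f' t)\<^sup>2))"

definition E_inf :: "real \<Rightarrow> real \<Rightarrow> real \<Rightarrow> real \<Rightarrow> real" where
  "E_inf \<gamma> K u_inf \<tau> = 1 / 2 * u_inf\<^sup>2 * (1 + 2 * \<tau>\<^sup>2 / ((\<gamma> - 1) * K\<^sup>2))"

definition p_inf :: "real \<Rightarrow> real \<Rightarrow> real \<Rightarrow> real \<Rightarrow> real \<Rightarrow> real" where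
  "p_inf \<gamma> K rho_inf u_inf \<tau> = rho_inf * u_inf\<^sup>2 * \<tau>\<^sup>2 / (\<gamma> * K\<^sup>2)"

definition u_A :: "real \<Rightarrow> real \<Rightarrow> (real \<Rightarrow> real) \<Rightarrow> (real \<Rightarrow> real) \<Rightarrow> real \<times> real \<Rightarrow> real" where
  "u_A u_inf \<tau> f f' = (\<lambda>(x, r).
     u_inf * indicator (Omega_as (\<lambda>x. \<tau> * f x)) (x, r)
     + 2 * u_inf * M_tau \<tau> f f' x / ((f x)\<^sup>2 * sqrt (1 + \<tau>\<^sup>2 * (f' x)\<^sup>2))
         * indicator (Gamma_as (\<lambda>x. \<tau> * f x)) (x, r))"

definition q_A :: "real \<Rightarrow> real \<Rightarrow> (real \<Rightarrow> real) \<Rightarrow> (real \<Rightarrow> real) \<Rightarrow> real \<times> real \<Rightarrow> real" where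
  "q_A u_inf \<tau> f f' = (\<lambda>(x, r).
     2 * \<tau> * u_inf * f' x * M_tau \<tau> f f' x / ((f x)\<^sup>2 * sqrt (1 + \<tau>\<^sup>2 * (f' x)\<^sup>2))
       * indicator (Gamma_as (\<lambda>x. \<tau> * f x)) (x, r))"

definition E_A :: "real \<Rightarrow> real \<Rightarrow> real \<Rightarrow> real \<Rightarrow> (real \<Rightarrow> real) \<Rightarrow> real \<times> real \<Rightarrow> real" where
  "E_A \<gamma> K u_inf \<tau> f = (\<lambda>P.
     E_inf \<gamma> K u_inf \<tau> * indicator (Omega_as (\<lambda>x. \<tau> * f x)) P
     + E_inf \<gamma> K u_inf \<tau> * indicator (Gamma_as (\<lambda>x. \<tau> * f x)) P)"

text \<open>At \<open>x = 0\<close> this reads \<open>0 / 0 = 0\<close>, which is the value by continuity.\<close>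

definition w_rho_A :: "real \<Rightarrow> real \<Rightarrow> (real \<Rightarrow> real) \<Rightarrow> (real \<Rightarrow> real) \<Rightarrow> real \<Rightarrow> real" where
  "w_rho_A rho_inf \<tau> f f' x = \<tau> * rho_inf * (f x) ^ 3 / (4 * M_tau \<tau> f f' x)"

definition w_p_A_formula ::
  "real \<Rightarrow> real \<Rightarrow> real \<Rightarrow> real \<Rightarrow> real \<Rightarrow> (real \<Rightarrow> real) \<Rightarrow> (real \<Rightarrow> real) \<Rightarrow> (real \<Rightarrow> real) \<Rightarrow> real \<Rightarrow> real"
where
  "w_p_A_formula \<gamma> K rho_inf u_inf \<tau> f f' f'' x =
     rho_inf * u_inf\<^sup>2 * \<tau>\<^sup>2 *
       (1 / (\<gamma> * K\<^sup>2)
        + (f'' x * M_tau \<tau> f f' x + sqrt (1 + \<tau>\<^sup>2 * (f' x)\<^sup>2) * f x * (f' x)\<^sup>2)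
            / (f x * (1 + \<tau>\<^sup>2 * (f' x)\<^sup>2) powr (3 / 2)))"

definition w_p_A ::
  "real \<Rightarrow> real \<Rightarrow> real \<Rightarrow> real \<Rightarrow> real \<Rightarrow> (real \<Rightarrow> real) \<Rightarrow> (real \<Rightarrow> real) \<Rightarrow> (real \<Rightarrow> real) \<Rightarrow> real \<Rightarrow> real"
where
  "w_p_A \<gamma> K rho_inf u_inf \<tau> f f' f'' x =
     (if x = 0 then Lim (at_right 0) (w_p_A_formula \<gamma> K rho_inf u_inf \<tau> f f' f'')
      else w_p_A_formula \<gamma> K rho_inf u_inf \<tau> f f' f'' x)"

text \<open>
  A point \<open>(x, y, z)\<close> in scaled coordinates with radius \<open>rad y z\<close> corresponds to the point
  \<open>(x, \<tau> * rad y z)\<close> of the physical half-plane.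
\<close>

definition rad :: "real \<Rightarrow> real \<Rightarrow> real" where
  "rad y z = sqrt (y\<^sup>2 + z\<^sup>2)"

definition u_scaled ::
  "real \<Rightarrow> real \<Rightarrow> (real \<Rightarrow> real) \<Rightarrow> (real \<Rightarrow> real) \<Rightarrow> real \<times> real \<times> real \<Rightarrow> real"
where
  "u_scaled u_inf \<tau> f f' = (\<lambda>(x, y, z).
     (u_A u_inf \<tau> f f' (x, \<tau> * rad y z) - u_inf) / (u_inf * \<tau>\<^sup>2))"

definition v_scaled ::
  "real \<Rightarrow> real \<Rightarrow> (real \<Rightarrow> real) \<Rightarrow> (real \<Rightarrow> real) \<Rightarrow> real \<times> real \<times> real \<Rightarrow> real"
where
  "v_scaled u_inf \<tau> f f' = (\<lambda>(x, y, z).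
     q_A u_inf \<tau> f f' (x, \<tau> * rad y z) / (u_inf * \<tau>) * (y / rad y z))"

definition w_scaled ::
  "real \<Rightarrow> real \<Rightarrow> (real \<Rightarrow> real) \<Rightarrow> (real \<Rightarrow> real) \<Rightarrow> real \<times> real \<times> real \<Rightarrow> real"
where
  "w_scaled u_inf \<tau> f f' = (\<lambda>(x, y, z).
     q_A u_inf \<tau> f f' (x, \<tau> * rad y z) / (u_inf * \<tau>) * (z / rad y z))"

definition E_scaled ::
  "real \<Rightarrow> real \<Rightarrow> real \<Rightarrow> real \<Rightarrow> (real \<Rightarrow> real) \<Rightarrow> real \<times> real \<times> real \<Rightarrow> real"
where
  "E_scaled \<gamma> K u_inf \<tau> f = (\<lambda>(x, y, z).
     (2 * E_A \<gamma> K u_inf \<tau> f (x, \<tau> * rad y z) - u_inf\<^sup>2) / (u_inf\<^sup>2 * \<tau>\<^sup>2))"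

definition rho_scaled_as ::
  "real \<Rightarrow> real \<Rightarrow> (real \<Rightarrow> real) \<Rightarrow> (real \<Rightarrow> real) \<Rightarrow> (real \<times> real) measure"
where
  "rho_scaled_as rho_inf \<tau> f f' =
     scale_measure (ennreal \<tau>)
       (plus_measure (restr_measure L2_as (Omega_as f))
          (curve_measure f
             (\<lambda>x. w_rho_A rho_inf \<tau> f f' x / (\<tau> * rho_inf) * f x * sqrt (1 + \<tau>\<^sup>2 * (f' x)\<^sup>2))))"

definition rho_scaled ::
  "real \<Rightarrow> real \<Rightarrow> (real \<Rightarrow> real) \<Rightarrow> (real \<Rightarrow> real) \<Rightarrow> (real \<times> real \<times> real) measure"
where
  "rho_scaled rho_inf \<tau> f f' = axisym (rho_scaled_as rho_inf \<tau> f f')"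

definition w_p_scaled ::
  "real \<Rightarrow> real \<Rightarrow> real \<Rightarrow> real \<Rightarrow> real \<Rightarrow> (real \<Rightarrow> real) \<Rightarrow> (real \<Rightarrow> real) \<Rightarrow> (real \<Rightarrow> real) \<Rightarrow> real \<Rightarrow> real"
where
  "w_p_scaled \<gamma> K rho_inf u_inf \<tau> f f' f'' x =
     w_p_A \<gamma> K rho_inf u_inf \<tau> f f' f'' x / (\<gamma> * p_inf \<gamma> K rho_inf u_inf \<tau> * K\<^sup>2)"

definition E_bar_inf :: "real \<Rightarrow> real \<Rightarrow> real" where
  "E_bar_inf \<gamma> K = 2 / ((\<gamma> - 1) * K\<^sup>2)"

definition p_bar_inf :: "real \<Rightarrow> real \<Rightarrow> real" where
  "p_bar_inf \<gamma> K = 1 / (\<gamma> * K\<^sup>2)"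

definition u_B_as :: "(real \<Rightarrow> real) \<Rightarrow> (real \<Rightarrow> real) \<Rightarrow> (real \<Rightarrow> real) \<Rightarrow> real \<times> real \<Rightarrow> real" where
  "u_B_as f f' f'' = (\<lambda>(x, r).
     (- (f' x)\<^sup>2 + integral {0..x} (\<lambda>t. (f t)\<^sup>2 * f' t * f'' t) / (f x)\<^sup>2)
       * indicator (Gamma_as f) (x, r))"

definition q_B_as :: "(real \<Rightarrow> real) \<Rightarrow> (real \<Rightarrow> real) \<Rightarrow> real \<times> real \<Rightarrow> real" where
  "q_B_as f f' = (\<lambda>(x, r). f' x * indicator (Gamma_as f) (x, r))"

definition E_B_as :: "real \<Rightarrow> real \<Rightarrow> (real \<Rightarrow> real) \<Rightarrow> real \<times> real \<Rightarrow> real" where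
  "E_B_as \<gamma> K f = (\<lambda>P. E_bar_inf \<gamma> K * indicator (Omega_as f) P
                        + E_bar_inf \<gamma> K * indicator (Gamma_as f) P)"

definition rho_B_as :: "(real \<Rightarrow> real) \<Rightarrow> (real \<Rightarrow> real) \<Rightarrow> (real \<times> real) measure" where
  "rho_B_as f f' =
     plus_measure (restr_measure L2_as (Omega_as f))
       (circ_dirac f f' (\<lambda>x. f x / (2 * sqrt (1 + (f' x)\<^sup>2))))"

definition u_B :: "(real \<Rightarrow> real) \<Rightarrow> (real \<Rightarrow> real) \<Rightarrow> (real \<Rightarrow> real) \<Rightarrow> real \<times> real \<times> real \<Rightarrow> real" where
  "u_B f f' f'' = (\<lambda>(x, y, z). u_B_as f f' f'' (x, rad y z))"

definition v_B :: "(real \<Rightarrow> real) \<Rightarrow> (real \<Rightarrow> real) \<Rightarrow> real \<times> real \<times> real \<Rightarrow> real" where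
  "v_B f f' = (\<lambda>(x, y, z). q_B_as f f' (x, rad y z) * (y / rad y z))"

definition w_B :: "(real \<Rightarrow> real) \<Rightarrow> (real \<Rightarrow> real) \<Rightarrow> real \<times> real \<times> real \<Rightarrow> real" where
  "w_B f f' = (\<lambda>(x, y, z). q_B_as f f' (x, rad y z) * (z / rad y z))"

definition E_B :: "real \<Rightarrow> real \<Rightarrow> (real \<Rightarrow> real) \<Rightarrow> real \<times> real \<times> real \<Rightarrow> real" where
  "E_B \<gamma> K f = (\<lambda>(x, y, z). E_B_as \<gamma> K f (x, rad y z))"

definition rho_B :: "(real \<Rightarrow> real) \<Rightarrow> (real \<Rightarrow> real) \<Rightarrow> (real \<times> real \<times> real) measure" where
  "rho_B f f' = axisym (rho_B_as f f')"

definition w_p_B ::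
  "real \<Rightarrow> real \<Rightarrow> (real \<Rightarrow> real) \<Rightarrow> (real \<Rightarrow> real) \<Rightarrow> (real \<Rightarrow> real) \<Rightarrow> real \<Rightarrow> real"
where
  "w_p_B \<gamma> K f f' f'' x = p_bar_inf \<gamma> K + (f' x)\<^sup>2 + 1 / 2 * f x * f'' x"

end

theory Submission
  imports Defs
begin

text \<open>
  Outside the bodies both solutions are the uniform oncoming flow, and the total enthalpy is constant
  throughout, so that the corresponding differences vanish identically there. Everything happens on the
  surface, where all quantities are explicit in \<open>f\<close>, \<open>f'\<close>, \<open>f''\<close> and the mass flux integral
  \<open>M\<^sub>\<tau>(x) = \<integral> f f' / s\<close> over \<open>[0, x]\<close>, with \<open>s = sqrt (1 + \<tau>\<^sup>2 f'\<^sup>2)\<close>.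

  Since \<open>1 - 1 / s = \<tau>\<^sup>2 f'\<^sup>2 / (s (1 + s))\<close>, one has exactly \<open>M\<^sub>\<tau> = f\<^sup>2 / 2 - \<tau>\<^sup>2 D\<^sub>\<tau>\<close> with
  \<open>D\<^sub>\<tau> = \<integral> f f'\<^sup>3 / (s (1 + s))\<close> (\<open>M_tau_eq_defect\<close>). As \<open>\<tau> \<rightarrow> 0\<close>, \<open>D\<^sub>\<tau>\<close> tends to half the integral of
  \<open>f f'\<^sup>3\<close>, which is \<open>f\<^sup>2 f'\<^sup>2 / 2 - \<integral> f\<^sup>2 f' f''\<close> by parts (\<open>tendsto_defect\<close>). The limit \<open>M\<^sub>\<tau> \<rightarrow> f\<^sup>2 / 2\<close>
  suffices for the radial velocity, the surface mass and the pressure coefficient; the axial velocity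
  is divided by \<open>\<tau>\<^sup>2\<close> and sees the defect as well (\<open>tendsto_surface_u\<close>).

  For the Radon--Nikodym derivatives, the mass measures have to be recognised as densities with
  respect to \<open>mu_bar\<close> (\<open>axisym_eq_density_mu_bar\<close>). Off the surface this is the statement that \<open>r dx dr\<close>
  in the half-plane corresponds to Lebesgue measure in space, that is, integration in polar coordinates
  (\<open>nn_integral_polar\<close>), obtained here from the substitutions \<open>z = y tan \<theta>\<close> and \<open>y = r cos \<theta>\<close>. On the
  surface one compares with the area element of a surface of revolution. As \<open>mu_bar\<close> is
  \<open>\<sigma>\<close>-finite, densities are unique almost everywhere; the explicit ones are constant off the surface, and
  on it they are functions of \<open>x\<close> that are continuous up to the vertex because \<open>f\<^sup>3 / M\<^sub>\<tau>\<close> is \<open>O(f)\<close>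
  (\<open>continuous_on_surface_weight\<close>).
\<close>

section \<open>Polar coordinates in the plane\<close>

text \<open>
  The map \<open>tan\<close> pushes the measure \<open>d\<theta> / cos\<^sup>2 \<theta>\<close> on \<open>(-\<pi>/2, \<pi>/2)\<close> forward to Lebesgue measure, since
  the two measures agree on intervals by the fundamental theorem of calculus.
\<close>

lemma nn_integral_tan:
  fixes G :: "real \<Rightarrow> ennreal"
  assumes [measurable]: "G \<in> borel_measurable borel"
  shows "(\<integral>\<^sup>+z. G z \<partial>lborel) =
         (\<integral>\<^sup>+\<theta>. ennreal (inverse ((cos \<theta>)\<^sup>2)) * indicator {-(pi/2)<..<pi/2} \<theta> * G (tan \<theta>) \<partial>lborel)"
proof -
  let ?w = "\<lambda>\<theta>::real. ennreal (inverse ((cos \<theta>)\<^sup>2)) * indicator {-(pi/2)<..<pi/2} \<theta>"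
  have [measurable]: "tan \<in> borel_measurable (borel :: real measure)"
    unfolding tan_def[abs_def] by measurable
  define M where "M = distr (density lborel ?w) borel (tan :: real \<Rightarrow> real)"
  have "lborel = M"
  proof (rule lborel_eqI)
    fix l u :: real
    assume "\<And>b. b \<in> Basis \<Longrightarrow> l \<bullet> b \<le> u \<bullet> b"
    then have lu: "l \<le> u" by simp
    have "emeasure M (box l u) = (\<integral>\<^sup>+\<theta>. ?w \<theta> * indicator (tan -` box l u) \<theta> \<partial>lborel)"
    proof -
      have [measurable]: "tan -` box l u \<in> sets borel"
        using measurable_sets_borel[OF \<open>tan \<in> borel_measurable borel\<close>, of "box l u"] by simp
      show ?thesis unfolding M_def by (subst emeasure_distr) (auto simp: emeasure_density simp del: box_real)
    qed
    also have "\<dots> = (\<integral>\<^sup>+\<theta>. ennreal (inverse ((cos \<theta>)\<^sup>2)) * indicator {arctan l..arctan u} \<theta> \<partial>lborel)"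
    proof (rule nn_integral_cong_AE)
      have iff: "\<theta> \<in> {-(pi/2)<..<pi/2} \<and> tan \<theta> \<in> box l u \<longleftrightarrow> \<theta> \<in> {arctan l<..<arctan u}" for \<theta>
      proof
        assume "\<theta> \<in> {-(pi/2)<..<pi/2} \<and> tan \<theta> \<in> box l u"
        then have "arctan (tan \<theta>) = \<theta>" "l < tan \<theta>" "tan \<theta> < u"
          by (auto intro!: arctan_tan)
        then show "\<theta> \<in> {arctan l<..<arctan u}"
          by (metis arctan_less_iff greaterThanLessThan_iff)
      next
        assume *: "\<theta> \<in> {arctan l<..<arctan u}"
        have "- (pi/2) < arctan l" "arctan u < pi/2"
          using arctan_lbound arctan_ubound by auto
        with * have I: "\<theta> \<in> {-(pi/2)<..<pi/2}" by auto
        then have "arctan (tan \<theta>) = \<theta>" by (auto intro!: arctan_tan)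
        with * I show "\<theta> \<in> {-(pi/2)<..<pi/2} \<and> tan \<theta> \<in> box l u"
          by (metis arctan_less_iff box_real(1) greaterThanLessThan_iff)
      qed
      have "AE \<theta> in lborel. \<theta> \<noteq> arctan l \<and> \<theta> \<noteq> arctan u"
        using AE_lborel_singleton[of "arctan l"] AE_lborel_singleton[of "arctan u"] by eventually_elim simp
      then show "AE \<theta> in lborel. ?w \<theta> * indicator (tan -` box l u) \<theta>
                  = ennreal (inverse ((cos \<theta>)\<^sup>2)) * indicator {arctan l..arctan u} \<theta>"
      proof eventually_elim
        case (elim \<theta>)
        then show ?case using iff[of \<theta>] by (auto simp: indicator_def)
      qed
    qed
    also have "\<dots> = ennreal (tan (arctan u) - tan (arctan l))"
    proof (rule nn_integral_FTC_Icc)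
      show "arctan l \<le> arctan u" using lu by (simp add: arctan_le_iff)
      fix x assume x: "x \<in> {arctan l..arctan u}"
      then have "- (pi/2) < x" "x < pi/2"
        using arctan_lbound[of l] arctan_ubound[of u] by auto
      then have "cos x \<noteq> 0" using cos_gt_zero_pi by force
      then show "(tan has_real_derivative inverse ((cos x)\<^sup>2)) (at x)"
        by (rule DERIV_tan)
    qed auto
    finally show "emeasure M (box l u) = (\<Prod>b\<in>Basis. (u - l) \<bullet> b)"
      by (simp add: tan_arctan)
  qed (simp add: M_def)
  then have "(\<integral>\<^sup>+z. G z \<partial>lborel) = (\<integral>\<^sup>+z. G z \<partial>M)" by simp
  also have "\<dots> = (\<integral>\<^sup>+\<theta>. ?w \<theta> * G (tan \<theta>) \<partial>lborel)"
    by (simp add: M_def nn_integral_distr nn_integral_density)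
  finally show ?thesis .
qed

text \<open>
  For fixed \<open>y > 0\<close> substitute \<open>z = y tan \<theta>\<close>; then exchange the integrals and, for fixed \<open>\<theta>\<close>,
  substitute \<open>y = r cos \<theta>\<close>. The factor \<open>ennreal r\<close> restricts the radial integral to \<open>r > 0\<close>.
\<close>

lemma nn_integral_polar_half_plane:
  fixes F :: "real \<times> real \<Rightarrow> ennreal"
  assumes [measurable]: "F \<in> borel_measurable borel"
  shows "(\<integral>\<^sup>+y. indicator {0<..} y * (\<integral>\<^sup>+z. F (y, z) \<partial>lborel) \<partial>lborel) =
         (\<integral>\<^sup>+\<theta>. indicator {-(pi/2)<..<pi/2} \<theta>
             * (\<integral>\<^sup>+r. ennreal r * F (r * cos \<theta>, r * sin \<theta>) \<partial>lborel) \<partial>lborel)"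
proof -
  let ?w = "\<lambda>\<theta>::real. ennreal (inverse ((cos \<theta>)\<^sup>2)) * indicator {-(pi/2)<..<pi/2} \<theta>"
  have [measurable]: "tan \<in> borel_measurable (borel :: real measure)"
    unfolding tan_def[abs_def] by measurable
  have [measurable]: "(\<lambda>x. F (f x, g x)) \<in> borel_measurable N"
    if [measurable]: "f \<in> borel_measurable N" "g \<in> borel_measurable N" for f g and N :: "'z measure"
    by measurable
  have inner: "indicator {0<..} y * (\<integral>\<^sup>+z. F (y, z) \<partial>lborel)
      = (\<integral>\<^sup>+\<theta>. ennreal y * (?w \<theta> * F (y, y * tan \<theta>)) \<partial>lborel)" for y
  proof (cases "y > 0")
    case True
    have "(\<integral>\<^sup>+z. F (y, z) \<partial>lborel) = ennreal y * (\<integral>\<^sup>+z. F (y, y * z) \<partial>lborel)"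
      using True by (subst nn_integral_real_affine[where c = y and t = 0]) auto
    also have "(\<integral>\<^sup>+z. F (y, y * z) \<partial>lborel) = (\<integral>\<^sup>+\<theta>. ?w \<theta> * F (y, y * tan \<theta>) \<partial>lborel)"
      by (rule nn_integral_tan) measurable
    finally show ?thesis using True by (simp add: nn_integral_cmult)
  qed (simp add: ennreal_neg)
  have radial: "(\<integral>\<^sup>+y. ennreal y * (?w \<theta> * F (y, y * tan \<theta>)) \<partial>lborel)
      = indicator {-(pi/2)<..<pi/2} \<theta> * (\<integral>\<^sup>+r. ennreal r * F (r * cos \<theta>, r * sin \<theta>) \<partial>lborel)" for \<theta>
  proof (cases "\<theta> \<in> {-(pi/2)<..<pi/2}")
    case True
    then have c: "cos \<theta> > 0" using cos_gt_zero_pi by force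
    have eq: "ennreal (cos \<theta>) * (ennreal (0 + cos \<theta> * r) * (?w \<theta> * F (0 + cos \<theta> * r, (0 + cos \<theta> * r) * tan \<theta>)))
          = ennreal r * F (r * cos \<theta>, r * sin \<theta>)" for r
    proof -
      have "ennreal (cos \<theta>) * ennreal (cos \<theta> * r) * ennreal (inverse ((cos \<theta>)\<^sup>2)) = ennreal r"
      proof (cases "r \<ge> 0")
        case True
        then show ?thesis using c
          by (simp add: ennreal_mult[symmetric] power2_eq_square field_simps)
      next
        case False
        then show ?thesis using c
          by (simp add: ennreal_neg mult_pos_neg less_imp_le mult_le_0_iff)
      qed
      then have "ennreal (cos \<theta>) * (ennreal (cos \<theta> * r) * (ennreal (inverse ((cos \<theta>)\<^sup>2)) * v)) = ennreal r * v" for v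
        by (simp only: mult.assoc[symmetric])
      moreover have "(cos \<theta> * r) * tan \<theta> = r * sin \<theta>" using c by (simp add: tan_def)
      ultimately show ?thesis using True
        by (simp only: add_0_left mult.commute[of "cos \<theta>" r] indicator_simps mult_1_right)
    qed
    have "(\<integral>\<^sup>+y. ennreal y * (?w \<theta> * F (y, y * tan \<theta>)) \<partial>lborel)
       = ennreal \<bar>cos \<theta>\<bar> * (\<integral>\<^sup>+r. ennreal (0 + cos \<theta> * r) * (?w \<theta> * F (0 + cos \<theta> * r, (0 + cos \<theta> * r) * tan \<theta>)) \<partial>lborel)"
      using c by (intro nn_integral_real_affine) auto
    also have "\<dots> = (\<integral>\<^sup>+r. ennreal r * F (r * cos \<theta>, r * sin \<theta>) \<partial>lborel)"
      using c by (subst nn_integral_cmult[symmetric]) (auto simp: eq[simplified])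
    finally show ?thesis using True by simp
  qed simp
  have "(\<integral>\<^sup>+y. indicator {0<..} y * (\<integral>\<^sup>+z. F (y, z) \<partial>lborel) \<partial>lborel)
      = (\<integral>\<^sup>+\<theta>. \<integral>\<^sup>+y. ennreal y * (?w \<theta> * F (y, y * tan \<theta>)) \<partial>lborel \<partial>lborel)"
    unfolding inner by (rule lborel_pair.Fubini') measurable
  then show ?thesis unfolding radial .
qed

lemma nn_integral_polar:
  fixes F :: "real \<times> real \<Rightarrow> ennreal"
  assumes [measurable]: "F \<in> borel_measurable borel"
  shows "(\<integral>\<^sup>+y. \<integral>\<^sup>+z. F (y, z) \<partial>lborel \<partial>lborel) =
         (\<integral>\<^sup>+\<theta>. indicator {-pi..pi} \<theta>
             * (\<integral>\<^sup>+r. ennreal r * F (r * cos \<theta>, r * sin \<theta>) \<partial>lborel) \<partial>lborel)"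
proof -
  have [measurable]: "(\<lambda>x. F (f x, g x)) \<in> borel_measurable N"
    if [measurable]: "f \<in> borel_measurable N" "g \<in> borel_measurable N" for f g and N :: "'z measure"
    by measurable
  define \<Phi> where "\<Phi> \<theta> = (\<integral>\<^sup>+r. ennreal r * F (r * cos \<theta>, r * sin \<theta>) \<partial>lborel)" for \<theta>
  define L where "L y = (\<integral>\<^sup>+z. F (y, z) \<partial>lborel)" for y
  have [measurable]: "\<Phi> \<in> borel_measurable borel" "L \<in> borel_measurable borel"
    unfolding \<Phi>_def[abs_def] L_def[abs_def] by measurable
  have right: "(\<integral>\<^sup>+y. indicator {0<..} y * L y \<partial>lborel) = (\<integral>\<^sup>+\<theta>. indicator {-(pi/2)<..<pi/2} \<theta> * \<Phi> \<theta> \<partial>lborel)"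
    unfolding L_def \<Phi>_def by (rule nn_integral_polar_half_plane) measurable
  have neg: "(\<integral>\<^sup>+x. G x \<partial>lborel) = (\<integral>\<^sup>+x. G (- x) \<partial>lborel)" if "G \<in> borel_measurable borel" for G :: "real \<Rightarrow> ennreal"
    using nn_integral_real_affine[OF that, of "-1" 0] by simp
  have shift: "(\<integral>\<^sup>+x. G x \<partial>lborel) = (\<integral>\<^sup>+x. G (t + x) \<partial>lborel)" if "G \<in> borel_measurable borel" for G :: "real \<Rightarrow> ennreal" and t
    using nn_integral_real_affine[OF that, of 1 t] by simp
  \<comment> \<open>The left half-plane is the right one rotated by the angle \<open>\<pi>\<close>.\<close>
  have "(\<integral>\<^sup>+y. indicator {..<0} y * L y \<partial>lborel) = (\<integral>\<^sup>+y. indicator {0<..} y * L (- y) \<partial>lborel)"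
    by (subst neg) (auto intro!: nn_integral_cong simp: indicator_def)
  also have "\<dots> = (\<integral>\<^sup>+y. indicator {0<..} y * (\<integral>\<^sup>+z. F (- y, - z) \<partial>lborel) \<partial>lborel)"
    unfolding L_def by (subst neg) auto
  also have "\<dots> = (\<integral>\<^sup>+\<theta>. indicator {-(pi/2)<..<pi/2} \<theta>
             * (\<integral>\<^sup>+r. ennreal r * F (- (r * cos \<theta>), - (r * sin \<theta>)) \<partial>lborel) \<partial>lborel)"
  proof -
    have "(\<lambda>p. F (- fst p, - snd p)) \<in> borel_measurable borel"
      by (rule measurable_compose[OF _ assms], rule borel_measurable_continuous_onI)
         (intro continuous_intros)
    from nn_integral_polar_half_plane[OF this] show ?thesis by simp
  qed
  also have "\<dots> = (\<integral>\<^sup>+\<theta>. indicator {-(pi/2)<..<pi/2} \<theta> * \<Phi> (\<theta> + pi) \<partial>lborel)"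
    unfolding \<Phi>_def by simp
  also have "\<dots> = (\<integral>\<^sup>+\<theta>. indicator {-(pi/2)<..<pi/2} (\<theta> - pi) * \<Phi> \<theta> \<partial>lborel)"
    using shift[of "\<lambda>\<theta>. indicator {-(pi/2)<..<pi/2} (\<theta> - pi) * \<Phi> \<theta>" pi] by (simp add: add.commute)
  also have "\<dots> = (\<integral>\<^sup>+\<theta>. indicator {pi/2<..pi} \<theta> * \<Phi> \<theta> + indicator {pi<..<3*pi/2} \<theta> * \<Phi> \<theta> \<partial>lborel)"
    by (auto intro!: nn_integral_cong simp: indicator_def)
  also have "\<dots> = (\<integral>\<^sup>+\<theta>. indicator {pi/2<..pi} \<theta> * \<Phi> \<theta> \<partial>lborel) + (\<integral>\<^sup>+\<theta>. indicator {pi<..<3*pi/2} \<theta> * \<Phi> \<theta> \<partial>lborel)"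
    by (rule nn_integral_add) auto
  also have "(\<integral>\<^sup>+\<theta>. indicator {pi<..<3*pi/2} \<theta> * \<Phi> \<theta> \<partial>lborel)
      = (\<integral>\<^sup>+\<theta>. indicator {-pi<..<-(pi/2)} \<theta> * \<Phi> \<theta> \<partial>lborel)"
    using shift[of "\<lambda>\<theta>. indicator {pi<..<3*pi/2} \<theta> * \<Phi> \<theta>" "2 * pi"]
    by (auto intro!: nn_integral_cong simp: indicator_def \<Phi>_def cos_add sin_add)
  finally have left: "(\<integral>\<^sup>+y. indicator {..<0} y * L y \<partial>lborel)
      = (\<integral>\<^sup>+\<theta>. indicator {pi/2<..pi} \<theta> * \<Phi> \<theta> \<partial>lborel) + (\<integral>\<^sup>+\<theta>. indicator {-pi<..<-(pi/2)} \<theta> * \<Phi> \<theta> \<partial>lborel)" .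
  have "(\<integral>\<^sup>+y. L y \<partial>lborel) = (\<integral>\<^sup>+y. indicator {0<..} y * L y + indicator {..<0} y * L y \<partial>lborel)"
    using AE_lborel_singleton[of "0::real"]
    by (intro nn_integral_cong_AE) (auto elim!: eventually_mono simp: indicator_def)
  also have "\<dots> = (\<integral>\<^sup>+y. indicator {0<..} y * L y \<partial>lborel) + (\<integral>\<^sup>+y. indicator {..<0} y * L y \<partial>lborel)"
    by (rule nn_integral_add) auto
  also have "\<dots> = (\<integral>\<^sup>+\<theta>. indicator {-(pi/2)<..<pi/2} \<theta> * \<Phi> \<theta>
        + (indicator {pi/2<..pi} \<theta> * \<Phi> \<theta> + indicator {-pi<..<-(pi/2)} \<theta> * \<Phi> \<theta>) \<partial>lborel)"
    unfolding right left by (simp add: nn_integral_add)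
  also have "\<dots> = (\<integral>\<^sup>+\<theta>. indicator {-pi..pi} \<theta> * \<Phi> \<theta> \<partial>lborel)"
  proof (rule nn_integral_cong_AE)
    have "AE \<theta> in lborel. \<theta> \<noteq> pi/2 \<and> \<theta> \<noteq> -(pi/2) \<and> \<theta> \<noteq> -pi"
      using AE_lborel_singleton[of "pi/2"] AE_lborel_singleton[of "-(pi/2)"] AE_lborel_singleton[of "-pi"]
      by eventually_elim simp
    then show "AE \<theta> in lborel. indicator {-(pi/2)<..<pi/2} \<theta> * \<Phi> \<theta>
        + (indicator {pi/2<..pi} \<theta> * \<Phi> \<theta> + indicator {-pi<..<-(pi/2)} \<theta> * \<Phi> \<theta>)
        = indicator {-pi..pi} \<theta> * \<Phi> \<theta>"
      by eventually_elim (auto simp: indicator_def)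
  qed
  finally show ?thesis unfolding L_def \<Phi>_def .
qed

section \<open>Sums of measures\<close>

lemma space_plus_measure [simp]: "space (plus_measure M N) = space M"
  and sets_plus_measure [simp, measurable_cong]: "sets (plus_measure M N) = sets M"
  by (simp_all add: plus_measure_def)

lemma emeasure_plus_measure:
  assumes [simp]: "sets M = sets N" and A: "A \<in> sets M"
  shows "emeasure (plus_measure M N) A = emeasure M A + emeasure N A"
  unfolding plus_measure_def
proof (rule emeasure_measure_of_sigma)
  show "sigma_algebra (space M) (sets M)" ..
  show "positive (sets M) (\<lambda>A. emeasure M A + emeasure N A)"
    by (simp add: positive_def)
  show "countably_additive (sets M) (\<lambda>A. emeasure M A + emeasure N A)"
  proof (rule countably_additiveI)
    fix B :: "nat \<Rightarrow> 'a set"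
    assume "range B \<subseteq> sets M" "disjoint_family B" "(\<Union>i. B i) \<in> sets M"
    then show "(\<Sum>i. emeasure M (B i) + emeasure N (B i)) = emeasure M (\<Union>i. B i) + emeasure N (\<Union>i. B i)"
      by (subst suminf_add[symmetric]) (auto simp: suminf_emeasure)
  qed
qed fact

lemma nn_integral_plus_measure:
  assumes [simp]: "sets M = sets N" and f: "f \<in> borel_measurable M"
  shows "(\<integral>\<^sup>+x. f x \<partial>plus_measure M N) = (\<integral>\<^sup>+x. f x \<partial>M) + (\<integral>\<^sup>+x. f x \<partial>N)"
proof -
  have sp: "space M = space N" using sets_eq_imp_space_eq[OF assms(1)] .
  have mN: "g \<in> borel_measurable M \<longleftrightarrow> g \<in> borel_measurable N" for g :: "'a \<Rightarrow> ennreal"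
    by (rule arg_cong[where f = "\<lambda>S. g \<in> S"], rule measurable_cong_sets) simp_all
  have mP: "g \<in> borel_measurable (plus_measure M N) \<longleftrightarrow> g \<in> borel_measurable M" for g :: "'a \<Rightarrow> ennreal"
    by (rule arg_cong[where f = "\<lambda>S. g \<in> S"], rule measurable_cong_sets) simp_all
  from f show ?thesis
  proof (induction rule: borel_measurable_induct)
    case (cong f g)
    have "(\<integral>\<^sup>+x. f x \<partial>L) = (\<integral>\<^sup>+x. g x \<partial>L)" if "space L = space M" for L
      using cong(3) that by (intro nn_integral_cong) auto
    then show ?case using cong(4) sp by simp
  next
    case (set A)
    then show ?case by (simp add: emeasure_plus_measure)
  next
    case (mult u c)
    then show ?case by (simp add: nn_integral_cmult mN[symmetric] mP distrib_left)
  next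
    case (add u v)
    then show ?case by (simp add: nn_integral_add mN[symmetric] mP ac_simps)
  next
    case (seq U)
    then have UM: "\<And>i. U i \<in> borel_measurable M" by simp
    then have UN: "\<And>i. U i \<in> borel_measurable N" and UP: "\<And>i. U i \<in> borel_measurable (plus_measure M N)"
      by (simp_all add: mN[symmetric] mP)
    have SUP: "(\<integral>\<^sup>+x. (SUP i. U i) x \<partial>L) = (SUP i. \<integral>\<^sup>+x. U i x \<partial>L)"
      if "\<And>i. U i \<in> borel_measurable L" for L
      using nn_integral_monotone_convergence_SUP[OF \<open>incseq U\<close> that] by (simp add: image_comp)
    have "(\<integral>\<^sup>+x. (SUP i. U i) x \<partial>plus_measure M N)
        = (SUP i. (\<integral>\<^sup>+x. U i x \<partial>M) + (\<integral>\<^sup>+x. U i x \<partial>N))"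
      unfolding SUP[OF UP] using seq by simp
    also have "\<dots> = (SUP i. \<integral>\<^sup>+x. U i x \<partial>M) + (SUP i. \<integral>\<^sup>+x. U i x \<partial>N)"
      using \<open>incseq U\<close> by (intro ennreal_SUP_add) (auto simp: incseq_def le_fun_def intro!: nn_integral_mono)
    finally show ?case
      unfolding SUP[OF UM] SUP[OF UN] .
  qed
qed

section \<open>The measures on the half-plane and their axisymmetric counterparts\<close>

lemma sets_restr_measure [simp, measurable_cong]: "sets (restr_measure M A) = sets M"
  by (simp add: restr_measure_def)

lemma nn_integral_restr_measure:
  assumes "A \<in> sets M" "f \<in> borel_measurable M"
  shows "(\<integral>\<^sup>+x. f x \<partial>restr_measure M A) = (\<integral>\<^sup>+x. indicator A x * f x \<partial>M)"
  using assms by (simp add: restr_measure_def nn_integral_density)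

lemma sets_L2_as [simp, measurable_cong]: "sets L2_as = sets borel"
  by (simp add: L2_as_def)

lemma nn_integral_L2_as:
  assumes "f \<in> borel_measurable borel"
  shows "(\<integral>\<^sup>+p. f p \<partial>L2_as) = (\<integral>\<^sup>+p. ennreal (snd p) * f p \<partial>lborel)"
proof -
  have "snd \<in> borel_measurable (borel :: (real \<times> real) measure)"
    by (intro borel_measurable_continuous_onI continuous_intros)
  then show ?thesis using assms
    by (simp add: L2_as_def case_prod_beta' nn_integral_density)
qed

lemma sets_curve_measure [simp, measurable_cong]: "sets (curve_measure g a) = sets borel"
  by (simp add: curve_measure_def)

lemma measurable_restrict_lborel:
  fixes f :: "'a::euclidean_space \<Rightarrow> 'b::topological_space"
  assumes "continuous_on D f"
  shows "f \<in> borel_measurable (restrict_space lborel D)"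
  using borel_measurable_continuous_on_restrict[OF assms]
  by (simp cong: measurable_cong_sets restrict_space_sets_cong)

lemma nn_integral_curve_measure:
  assumes g: "continuous_on {0..} g" and a: "continuous_on {0..} a"
    and G: "G \<in> borel_measurable borel"
  shows "(\<integral>\<^sup>+p. G p \<partial>curve_measure g a)
       = (\<integral>\<^sup>+x. indicator {0..} x * (ennreal (a x) * G (x, g x)) \<partial>lborel)"
proof -
  let ?R = "restrict_space lborel {0::real..}"
  have curve: "(\<lambda>x. (x, g x)) \<in> borel_measurable ?R"
    by (intro measurable_restrict_lborel continuous_intros g)
  have "a \<in> borel_measurable ?R" by (intro measurable_restrict_lborel a)
  then have "(\<integral>\<^sup>+p. G p \<partial>curve_measure g a) = (\<integral>\<^sup>+x. ennreal (a x) * G (x, g x) \<partial>?R)"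
    using curve G measurable_compose[OF curve G]
    by (simp add: curve_measure_def nn_integral_distr nn_integral_density)
  then show ?thesis by (simp add: nn_integral_restrict_space mult.commute)
qed

lemma nn_integral_axisym:
  assumes [measurable_cong]: "sets \<nu> = sets borel" and [measurable]: "G \<in> borel_measurable borel"
  shows "(\<integral>\<^sup>+p. G p \<partial>axisym \<nu>)
       = (\<integral>\<^sup>+p. \<integral>\<^sup>+\<theta>. indicator {-pi..pi} \<theta> * G (fst p, snd p * cos \<theta>, snd p * sin \<theta>) \<partial>lborel \<partial>\<nu>)"
proof -
  let ?T = "restrict_space lborel {-pi..pi}"
  interpret T: sigma_finite_measure ?T
    by (rule sigma_finite_measure_restrict_space) (auto intro: sigma_finite_lborel)
  have fst: "fst \<in> borel_measurable \<nu>" and snd: "snd \<in> borel_measurable \<nu>"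
    using borel_measurable_continuous_onI[of "fst :: real \<times> real \<Rightarrow> real"]
      borel_measurable_continuous_onI[of "snd :: real \<times> real \<Rightarrow> real"]
    by (simp_all add: continuous_on_fst continuous_on_snd cong: measurable_cong_sets)
  have ang: "(\<lambda>\<theta>. \<theta>) \<in> borel_measurable ?T"
    by (rule measurable_restrict_lborel) (intro continuous_intros)
  have [measurable]: "(\<lambda>q. fst (fst q)) \<in> borel_measurable (\<nu> \<Otimes>\<^sub>M ?T)"
    "(\<lambda>q. snd (fst q)) \<in> borel_measurable (\<nu> \<Otimes>\<^sub>M ?T)" "(\<lambda>q. snd q) \<in> borel_measurable (\<nu> \<Otimes>\<^sub>M ?T)"
    using measurable_compose[OF measurable_fst fst] measurable_compose[OF measurable_fst snd]
      measurable_compose[OF measurable_snd ang] by auto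
  have rot: "(\<lambda>((x, r), \<theta>). (x, r * cos \<theta>, r * sin \<theta>)) \<in> borel_measurable (\<nu> \<Otimes>\<^sub>M ?T)"
    unfolding case_prod_beta' by measurable
  have "(\<integral>\<^sup>+p. G p \<partial>axisym \<nu>)
      = (\<integral>\<^sup>+q. G ((\<lambda>((x, r), \<theta>). (x, r * cos \<theta>, r * sin \<theta>)) q) \<partial>(\<nu> \<Otimes>\<^sub>M ?T))"
    unfolding axisym_def by (rule nn_integral_distr[OF rot]) simp
  also have "\<dots> = (\<integral>\<^sup>+p. \<integral>\<^sup>+\<theta>. G (fst p, snd p * cos \<theta>, snd p * sin \<theta>) \<partial>?T \<partial>\<nu>)"
    using measurable_compose[OF rot assms(2)]
    by (subst T.nn_integral_fst[symmetric]) (auto simp: case_prod_beta)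
  finally show ?thesis by (simp add: nn_integral_restrict_space mult.commute)
qed

text \<open>
  The area element of a surface of revolution at radius \<open>r\<close> with slope \<open>d\<close> of the generatrix.
\<close>

lemma area_element_revolution:
  "area_element (1 :: real, d * cos \<theta>, d * sin \<theta>) (0 :: real, - r * sin \<theta>, r * cos \<theta>)
     = \<bar>r\<bar> * sqrt (1 + d\<^sup>2)"
proof -
  have 1: "(norm (1 :: real, d * cos \<theta>, d * sin \<theta>))\<^sup>2 = 1 + d\<^sup>2 * ((cos \<theta>)\<^sup>2 + (sin \<theta>)\<^sup>2)"
    by (simp only: norm_Pair real_norm_def real_sqrt_pow2 sum_power2_ge_zero add_nonneg_nonneg zero_le_power2 power2_abs)
       (simp add: power_mult_distrib distrib_left[symmetric])
  have 2: "(norm (0 :: real, - r * sin \<theta>, r * cos \<theta>))\<^sup>2 = r\<^sup>2 * ((cos \<theta>)\<^sup>2 + (sin \<theta>)\<^sup>2)"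
    by (simp only: norm_Pair real_norm_def real_sqrt_pow2 sum_power2_ge_zero add_nonneg_nonneg zero_le_power2 power2_abs)
       (simp add: power_mult_distrib distrib_left[symmetric])
  have 3: "(1 :: real, d * cos \<theta>, d * sin \<theta>) \<bullet> (0 :: real, - r * sin \<theta>, r * cos \<theta>) = 0"
    by (simp add: inner_Pair)
  show ?thesis
    unfolding area_element_def 1 2 3 by (simp add: real_sqrt_mult mult.commute)
qed

text \<open>
  Profiles are controlled on \<open>[0, \<infinity>)\<close> only; composing with \<open>max 0\<close> gives a continuous function on the
  whole line with the same values there.
\<close>

lemma continuous_on_max0:
  fixes g :: "real \<Rightarrow> 'a::topological_space"
  assumes "continuous_on {0..} g"
  shows "continuous_on UNIV (\<lambda>x. g (max 0 x))"
  by (rule continuous_on_compose2[OF assms]) (auto intro!: continuous_intros)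

lemma nn_integral_surface_Gamma3:
  assumes g: "continuous_on {0..} g" and g': "continuous_on {0..} g'"
    and pos: "\<And>x. 0 \<le> x \<Longrightarrow> 0 \<le> g x"
    and G: "G \<in> borel_measurable borel"
  shows "(\<integral>\<^sup>+p. G p \<partial>surface_Gamma3 g g')
       = (\<integral>\<^sup>+s. indicator {0..} s * (ennreal (g s * sqrt (1 + (g' s)\<^sup>2))
            * (\<integral>\<^sup>+\<theta>. indicator {-pi..pi} \<theta> * G (s, g s * cos \<theta>, g s * sin \<theta>) \<partial>lborel)) \<partial>lborel)"
proof -
  let ?D = "{0::real..} \<times> {-pi..pi}"
  let ?R = "restrict_space lborel ?D"
  let ?X = "\<lambda>p. (fst p, g (fst p) * cos (snd p), g (fst p) * sin (snd p))"
  let ?a = "\<lambda>p::real \<times> real. ennreal (area_element (1 :: real, g' (fst p) * cos (snd p), g' (fst p) * sin (snd p))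
                 (0 :: real, - g (fst p) * sin (snd p), g (fst p) * cos (snd p)))"
  have gf: "continuous_on ?D (\<lambda>p. g (fst p))" "continuous_on ?D (\<lambda>p. g' (fst p))"
    by (rule continuous_on_compose2[OF g] continuous_on_compose2[OF g'], intro continuous_intros, force)+
  have X: "?X \<in> borel_measurable ?R"
    by (intro measurable_restrict_lborel continuous_intros gf)
  have a: "(\<lambda>p. \<bar>g (fst p)\<bar> * sqrt (1 + (g' (fst p))\<^sup>2)) \<in> borel_measurable ?R"
    by (intro measurable_restrict_lborel continuous_intros gf)
  have D: "?D \<in> sets borel"
    by (intro borel_closed closed_Times) auto
  define g0 g0' where "g0 x = g (max 0 x)" and "g0' x = g' (max 0 x)" for x
  have [measurable]: "g0 \<in> borel_measurable borel" "g0' \<in> borel_measurable borel"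
    using continuous_on_max0[OF g] continuous_on_max0[OF g']
    by (auto intro!: borel_measurable_continuous_onI simp: g0_def[abs_def] g0'_def[abs_def])
  note [measurable] = G
  let ?I = "\<lambda>p. indicator {0..} (fst p) * (ennreal (g0 (fst p) * sqrt (1 + (g0' (fst p))\<^sup>2))
       * (indicator {-pi..pi} (snd p) * G (fst p, g0 (fst p) * cos (snd p), g0 (fst p) * sin (snd p))))"
  have "(\<integral>\<^sup>+p. G p \<partial>surface_Gamma3 g g') = (\<integral>\<^sup>+p. ?a p * G (?X p) \<partial>?R)"
    using X a measurable_compose[OF X G]
    by (simp add: surface_Gamma3_def surface_measure_def case_prod_beta' nn_integral_distr
        nn_integral_density area_element_revolution[unfolded mult_minus_left])
  also have "\<dots> = (\<integral>\<^sup>+p. ?a p * G (?X p) * indicator ?D p \<partial>lborel)"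
    using D by (simp add: nn_integral_restrict_space)
  also have "\<dots> = (\<integral>\<^sup>+p. ?I p \<partial>lborel)"
    by (intro nn_integral_cong)
       (auto simp: area_element_revolution[unfolded mult_minus_left] g0_def g0'_def pos indicator_def)
  also have "\<dots> = (\<integral>\<^sup>+s. \<integral>\<^sup>+\<theta>. ?I (s, \<theta>) \<partial>lborel \<partial>lborel)"
    unfolding lborel_prod[symmetric] by (subst lborel.nn_integral_fst[symmetric]) auto
  also have "\<dots> = (\<integral>\<^sup>+s. indicator {0..} s * (ennreal (g s * sqrt (1 + (g' s)\<^sup>2))
            * (\<integral>\<^sup>+\<theta>. indicator {-pi..pi} \<theta> * G (s, g s * cos \<theta>, g s * sin \<theta>) \<partial>lborel)) \<partial>lborel)"
    by (intro nn_integral_cong) (auto simp: nn_integral_cmult g0_def g0'_def indicator_def)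
  finally show ?thesis .
qed

lemma sets_Omega_as:
  assumes "continuous_on {0..} g"
  shows "Omega_as g \<in> sets borel"
proof -
  define g0 where "g0 x = g (max 0 x)" for x
  have [measurable]: "g0 \<in> borel_measurable borel"
    using continuous_on_max0[OF assms] by (auto intro!: borel_measurable_continuous_onI simp: g0_def[abs_def])
  have "Omega_as g = {p \<in> space (borel \<Otimes>\<^sub>M borel). 0 \<le> fst p \<and> g0 (fst p) < snd p}"
    by (auto simp: Omega_as_def g0_def space_pair_measure)
  also have "\<dots> \<in> sets (borel \<Otimes>\<^sub>M borel)" by measurable
  finally show ?thesis unfolding borel_prod .
qed

lemma sets_Omega3_Gamma3:
  assumes "continuous_on {0..} g"
  shows "Omega3 g \<in> sets borel" "Gamma3 g \<in> sets borel"
proof -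
  define g0 where "g0 x = g (max 0 x)" for x
  have [measurable]: "g0 \<in> borel_measurable borel"
    using continuous_on_max0[OF assms] by (auto intro!: borel_measurable_continuous_onI simp: g0_def[abs_def])
  let ?B = "borel \<Otimes>\<^sub>M (borel \<Otimes>\<^sub>M borel) :: (real \<times> real \<times> real) measure"
  have "Omega3 g = {p \<in> space ?B. 0 \<le> fst p \<and> (g0 (fst p))\<^sup>2 < (fst (snd p))\<^sup>2 + (snd (snd p))\<^sup>2}"
    by (auto simp: Omega3_def g0_def space_pair_measure)
  also have "\<dots> \<in> sets ?B" by measurable
  finally show "Omega3 g \<in> sets borel" unfolding borel_prod .
  have "Gamma3 g = {p \<in> space ?B. 0 \<le> fst p \<and> (fst (snd p))\<^sup>2 + (snd (snd p))\<^sup>2 = (g0 (fst p))\<^sup>2}"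
    by (auto simp: Gamma3_def g0_def space_pair_measure)
  also have "\<dots> \<in> sets ?B" by measurable
  finally show "Gamma3 g \<in> sets borel" unfolding borel_prod .
qed


text \<open>
  The inner integral in \<open>nn_integral_axisym\<close>, over the circle of radius \<open>r\<close> around the axis, is a Borel
  function of the point \<open>(x, r)\<close>.
\<close>

lemma measurable_circle_integral:
  assumes [measurable]: "G \<in> borel_measurable borel"
  shows "(\<lambda>p::real \<times> real. \<integral>\<^sup>+\<theta>. indicator {-pi..pi} \<theta> * G (fst p, snd p * cos \<theta>, snd p * sin \<theta>) \<partial>lborel)
           \<in> borel_measurable borel"
  unfolding borel_prod[symmetric] by measurable

text \<open>
  The axisymmetric measure that corresponds to \<open>L2_as\<close> on the outside of the generatrix is
  three-dimensional Lebesgue measure on the outside of the body.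
\<close>

lemma nn_integral_axisym_Omega_as:
  assumes g: "continuous_on {0..} g" and pos: "\<And>x. 0 \<le> x \<Longrightarrow> 0 \<le> g x"
    and [measurable]: "G \<in> borel_measurable borel"
  shows "(\<integral>\<^sup>+p. \<integral>\<^sup>+\<theta>. indicator {-pi..pi} \<theta> * G (fst p, snd p * cos \<theta>, snd p * sin \<theta>) \<partial>lborel
            \<partial>restr_measure L2_as (Omega_as g))
       = (\<integral>\<^sup>+p. indicator (Omega3 g) p * G p \<partial>lborel)"
proof -
  note [measurable] = sets_Omega_as[OF g] sets_Omega3_Gamma3(1)[OF g]
  have [measurable]: "(\<lambda>x. G (a x, b x, c x)) \<in> borel_measurable N"
    if [measurable]: "a \<in> borel_measurable N" "b \<in> borel_measurable N" "c \<in> borel_measurable N"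
    for a b c and N :: "'z measure"
    by measurable
  have [measurable]: "(\<lambda>x. indicator (Omega3 g) (a x, b x, c x) :: ennreal) \<in> borel_measurable N"
    if [measurable]: "a \<in> borel_measurable N" "b \<in> borel_measurable N" "c \<in> borel_measurable N"
    for a b c and N :: "'z measure"
    by measurable
  let ?P = "\<lambda>p. \<integral>\<^sup>+\<theta>. indicator {-pi..pi} \<theta> * G (fst p, snd p * cos \<theta>, snd p * sin \<theta>) \<partial>lborel"
  have P: "?P \<in> borel_measurable (borel :: (real \<times> real) measure)"
    by (rule measurable_circle_integral) measurable
  then have P': "?P \<in> borel_measurable L2_as"
    by (simp cong: measurable_cong_sets)
  have iO: "indicator (Omega_as g) \<in> borel_measurable (borel :: (real \<times> real) measure)" by measurable
  have F: "(\<lambda>q. indicator (Omega3 g) (x, q) * G (x, q)) \<in> borel_measurable borel" for x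
  proof -
    have "(\<lambda>q. (x, q)) \<in> borel \<rightarrow>\<^sub>M (borel :: (real \<times> real \<times> real) measure)"
      by (intro borel_measurable_continuous_onI continuous_intros)
    from measurable_compose[OF this, of "\<lambda>p. indicator (Omega3 g) p * G p" borel]
    show ?thesis by simp
  qed
  \<comment> \<open>For fixed \<open>x\<close>, polar coordinates in the cross-section.\<close>
  have slice: "(\<integral>\<^sup>+y. \<integral>\<^sup>+z. indicator (Omega3 g) (x, y, z) * G (x, y, z) \<partial>lborel \<partial>lborel)
       = (\<integral>\<^sup>+r. ennreal r * (indicator (Omega_as g) (x, r) * ?P (x, r)) \<partial>lborel)" for x
  proof -
    let ?F = "\<lambda>p. indicator (Omega3 g) (x, p) * G (x, p)"
    have iff: "(x, r * cos \<theta>, r * sin \<theta>) \<in> Omega3 g \<longleftrightarrow> (x, r) \<in> Omega_as g" if "r > 0" for r \<theta>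
    proof -
      have "(r * cos \<theta>)\<^sup>2 + (r * sin \<theta>)\<^sup>2 = r\<^sup>2"
        by (simp add: power_mult_distrib distrib_left[symmetric])
      then show ?thesis
        using that pos[of x] by (auto simp: Omega3_def Omega_as_def intro: power2_less_imp_less power_strict_mono)
    qed
    have "(\<integral>\<^sup>+y. \<integral>\<^sup>+z. ?F (y, z) \<partial>lborel \<partial>lborel)
        = (\<integral>\<^sup>+\<theta>. indicator {-pi..pi} \<theta> * (\<integral>\<^sup>+r. ennreal r * ?F (r * cos \<theta>, r * sin \<theta>) \<partial>lborel) \<partial>lborel)"
      by (rule nn_integral_polar[OF F])
    also have "\<dots> = (\<integral>\<^sup>+\<theta>. \<integral>\<^sup>+r. indicator {-pi..pi} \<theta> * (ennreal r * ?F (r * cos \<theta>, r * sin \<theta>)) \<partial>lborel \<partial>lborel)"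
      by (simp add: nn_integral_cmult)
    also have "\<dots> = (\<integral>\<^sup>+r. \<integral>\<^sup>+\<theta>. indicator {-pi..pi} \<theta> * (ennreal r * ?F (r * cos \<theta>, r * sin \<theta>)) \<partial>lborel \<partial>lborel)"
      by (rule lborel_pair.Fubini') measurable
    also have "\<dots> = (\<integral>\<^sup>+r. ennreal r * (indicator (Omega_as g) (x, r) * ?P (x, r)) \<partial>lborel)"
    proof (rule nn_integral_cong)
      fix r :: real
      show "(\<integral>\<^sup>+\<theta>. indicator {-pi..pi} \<theta> * (ennreal r * ?F (r * cos \<theta>, r * sin \<theta>)) \<partial>lborel)
          = ennreal r * (indicator (Omega_as g) (x, r) * ?P (x, r))"
      proof (cases "r > 0")
        case True
        have "(\<integral>\<^sup>+\<theta>. indicator {-pi..pi} \<theta> * (ennreal r * ?F (r * cos \<theta>, r * sin \<theta>)) \<partial>lborel)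
          = (\<integral>\<^sup>+\<theta>. (ennreal r * indicator (Omega_as g) (x, r))
                * (indicator {-pi..pi} \<theta> * G (x, r * cos \<theta>, r * sin \<theta>)) \<partial>lborel)"
          using iff[OF True] by (intro nn_integral_cong) (auto simp: indicator_def)
        also have "\<dots> = ennreal r * (indicator (Omega_as g) (x, r) * ?P (x, r))"
          by (subst nn_integral_cmult) (simp_all add: mult.assoc)
        finally show ?thesis .
      qed (simp add: ennreal_neg)
    qed
    finally show ?thesis by simp
  qed
  have "(\<integral>\<^sup>+p. ?P p \<partial>restr_measure L2_as (Omega_as g))
      = (\<integral>\<^sup>+p. ennreal (snd p) * (indicator (Omega_as g) p * ?P p) \<partial>lborel)"
    using P P' iO by (simp add: nn_integral_restr_measure nn_integral_L2_as)
  also have "\<dots> = (\<integral>\<^sup>+x. \<integral>\<^sup>+r. ennreal r * (indicator (Omega_as g) (x, r) * ?P (x, r)) \<partial>lborel \<partial>lborel)"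
  proof -
    have "(\<lambda>p. ennreal (snd p) * (indicator (Omega_as g) p * ?P p)) \<in> borel_measurable (lborel \<Otimes>\<^sub>M lborel)"
    proof -
      have "snd \<in> borel_measurable (borel :: (real \<times> real) measure)"
        by (intro borel_measurable_continuous_onI continuous_intros)
      then show ?thesis
        using P iO by (simp add: lborel_prod)
    qed
    then show ?thesis
      unfolding lborel_prod[symmetric] by (subst lborel.nn_integral_fst[symmetric]) auto
  qed
  also have "\<dots> = (\<integral>\<^sup>+x. \<integral>\<^sup>+y. \<integral>\<^sup>+z. indicator (Omega3 g) (x, y, z) * G (x, y, z) \<partial>lborel \<partial>lborel \<partial>lborel)"
    by (simp only: slice)
  also have "\<dots> = (\<integral>\<^sup>+x. \<integral>\<^sup>+q. indicator (Omega3 g) (x, q) * G (x, q) \<partial>lborel \<partial>lborel)"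
  proof (rule nn_integral_cong)
    fix x :: real
    have "(\<lambda>q. indicator (Omega3 g) (x, q) * G (x, q)) \<in> borel_measurable (lborel \<Otimes>\<^sub>M lborel)"
      using F by (simp add: lborel_prod)
    from lborel.nn_integral_fst[OF this]
    show "(\<integral>\<^sup>+y. \<integral>\<^sup>+z. indicator (Omega3 g) (x, y, z) * G (x, y, z) \<partial>lborel \<partial>lborel)
        = (\<integral>\<^sup>+q. indicator (Omega3 g) (x, q) * G (x, q) \<partial>lborel)"
      by (simp add: lborel_prod)
  qed
  also have "\<dots> = (\<integral>\<^sup>+p. indicator (Omega3 g) p * G p \<partial>lborel)"
  proof -
    have "(\<lambda>p. indicator (Omega3 g) p * G p) \<in> borel_measurable (lborel \<Otimes>\<^sub>M lborel)"
      by (simp add: lborel_prod)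
    from lborel.nn_integral_fst[OF this] show ?thesis by (simp add: lborel_prod)
  qed
  finally show ?thesis .
qed

section \<open>Densities with respect to volume plus surface measure\<close>

lemma sets_mu_bar [simp, measurable_cong]: "sets (mu_bar f f') = sets borel"
  by (simp add: mu_bar_def)

lemma nn_integral_mu_bar:
  assumes f: "continuous_on {0..} f" and f': "continuous_on {0..} f'"
    and pos: "\<And>x. 0 \<le> x \<Longrightarrow> 0 \<le> f x"
    and G: "G \<in> borel_measurable borel"
  shows "(\<integral>\<^sup>+p. G p \<partial>mu_bar f f')
       = (\<integral>\<^sup>+p. indicator (Omega3 f) p * G p \<partial>lborel)
         + (\<integral>\<^sup>+s. indicator {0..} s * (ennreal (f s * sqrt (1 + (f' s)\<^sup>2))
            * (\<integral>\<^sup>+\<theta>. indicator {-pi..pi} \<theta> * G (s, f s * cos \<theta>, f s * sin \<theta>) \<partial>lborel)) \<partial>lborel)"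
proof -
  have "sets (restr_measure lborel (Omega3 f)) = sets (surface_Gamma3 f f')"
    by (simp add: surface_Gamma3_def surface_measure_def)
  moreover have "G \<in> borel_measurable (restr_measure lborel (Omega3 f))"
    using G by (simp cong: measurable_cong_sets)
  ultimately show ?thesis
    using G sets_Omega3_Gamma3(1)[OF f]
    by (simp add: mu_bar_def nn_integral_plus_measure nn_integral_restr_measure
        nn_integral_surface_Gamma3[OF f f' pos G])
qed

text \<open>
  Balls have finite measure; this makes densities with respect to \<open>mu_bar\<close> unique up to null sets.
\<close>

lemma sigma_finite_mu_bar:
  assumes f: "continuous_on {0..} f" and f': "continuous_on {0..} f'"
    and pos: "\<And>x. 0 \<le> x \<Longrightarrow> 0 \<le> f x"
  shows "sigma_finite_measure (mu_bar f f')"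
proof
  let ?A = "range (\<lambda>n::nat. cball (0::real \<times> real \<times> real) (real n))"
  have "emeasure (mu_bar f f') (cball 0 (real n)) \<noteq> \<infinity>" for n
  proof -
    let ?C = "cball (0::real \<times> real \<times> real) (real n)"
    let ?a = "\<lambda>s. f s * sqrt (1 + (f' s)\<^sup>2)"
    have "continuous_on {0..real n} ?a"
      by (intro continuous_intros continuous_on_subset[OF f] continuous_on_subset[OF f']) auto
    then have "bounded (?a ` {0..real n})"
      by (intro compact_imp_bounded compact_continuous_image) auto
    then obtain B where B: "\<And>s. s \<in> {0..real n} \<Longrightarrow> ?a s \<le> B"
      unfolding bounded_iff by (force simp: abs_le_iff)
    have "emeasure (mu_bar f f') ?C = (\<integral>\<^sup>+p. indicator ?C p \<partial>mu_bar f f')"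
      by simp
    also have "\<dots> = (\<integral>\<^sup>+p. indicator (Omega3 f) p * indicator ?C p \<partial>lborel)
         + (\<integral>\<^sup>+s. indicator {0..} s * (ennreal (?a s)
            * (\<integral>\<^sup>+\<theta>. indicator {-pi..pi} \<theta> * indicator ?C (s, f s * cos \<theta>, f s * sin \<theta>) \<partial>lborel)) \<partial>lborel)"
      by (rule nn_integral_mu_bar[OF f f' pos]) (auto intro: borel_measurable_indicator)
    also have "\<dots> \<le> (\<integral>\<^sup>+p. indicator ?C p \<partial>lborel)
         + (\<integral>\<^sup>+s. ennreal B * ennreal (2 * pi) * indicator {0..real n} s \<partial>lborel)"
    proof (intro add_mono nn_integral_mono)
      fix s :: real
      have n: "\<bar>s\<bar> \<le> real n" if "(s, q) \<in> ?C" for q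
        using that norm_fst_le[of s q] by (simp add: mem_cball_0 del: mem_cball)
      let ?J = "\<integral>\<^sup>+\<theta>. indicator {-pi..pi} \<theta> * indicator ?C (s, f s * cos \<theta>, f s * sin \<theta>) \<partial>lborel :: ennreal"
      have le: "(indicator ?C (s, q) :: ennreal) \<le> indicator {-real n..real n} s" for q
        using n[of q] by (cases "(s, q) \<in> ?C") (auto simp: indicator_def abs_le_iff simp del: mem_cball)
      have "?J \<le> (\<integral>\<^sup>+\<theta>. indicator {-real n..real n} s * indicator {-pi..pi} \<theta> \<partial>lborel)"
        by (intro nn_integral_mono) (subst mult.commute, intro mult_right_mono le, simp)
      also have "\<dots> = indicator {-real n..real n} s * ennreal (2 * pi)"
        by (simp add: nn_integral_cmult)
      finally have J: "?J \<le> indicator {-real n..real n} s * ennreal (2 * pi)" .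
      show "indicator {0..} s * (ennreal (?a s) * ?J) \<le> ennreal B * ennreal (2 * pi) * indicator {0..real n} s"
      proof (cases "s \<in> {0..real n}")
        case True
        then have "ennreal (?a s) * ?J \<le> ennreal B * ennreal (2 * pi)"
          using B[OF True] J by (intro mult_mono ennreal_leI) simp_all
        with True show ?thesis by simp
      next
        case False
        then have "s < 0 \<or> ?J = 0" using J by auto
        then show ?thesis by auto
      qed
    qed (simp add: indicator_def)
    also have "\<dots> < \<infinity>"
      using emeasure_lborel_cball_finite[of "0::real \<times> real \<times> real" "real n"]
      by (simp add: nn_integral_cmult ennreal_mult_less_top)
    finally show ?thesis by simp
  qed
  moreover have "\<Union>?A = UNIV"
    using real_arch_simple by (auto simp: dist_norm)
  ultimately show "\<exists>A. countable A \<and> A \<subseteq> sets (mu_bar f f') \<and> \<Union>A = space (mu_bar f f')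
      \<and> (\<forall>a\<in>A. emeasure (mu_bar f f') a \<noteq> \<infinity>)"
    by (intro exI[of _ ?A]) (auto simp: sets_eq_imp_space_eq[OF sets_mu_bar])
qed

text \<open>
  The density with respect to \<open>mu_bar\<close> of a flow with density \<open>c\<close> outside the body and a
  concentration \<open>c * g x\<close> on its surface. It is \<open>0\<close> elsewhere.
\<close>

definition layer_density :: "(real \<Rightarrow> real) \<Rightarrow> real \<Rightarrow> (real \<Rightarrow> real) \<Rightarrow> real \<times> real \<times> real \<Rightarrow> real" where
  "layer_density f c g p = c * (indicator (Omega3 f) p + indicator (Gamma3 f) p * g (fst p))"

lemma layer_density_Omega3: "p \<in> Omega3 f \<Longrightarrow> layer_density f c g p = c"
  by (auto simp: layer_density_def Omega3_def Gamma3_def)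

lemma layer_density_Gamma3: "p \<in> Gamma3 f \<Longrightarrow> layer_density f c g p = c * g (fst p)"
  by (auto simp: layer_density_def Omega3_def Gamma3_def)

lemma borel_measurable_layer_density:
  assumes f: "continuous_on {0..} f" and g: "continuous_on {0..} g"
  shows "layer_density f c g \<in> borel_measurable borel"
proof -
  note [measurable] = sets_Omega3_Gamma3[OF f]
  have "continuous_on UNIV (\<lambda>p. g (max 0 (fst p)))"
    by (rule continuous_on_compose2[OF g]) (auto intro!: continuous_intros)
  then have [measurable]: "(\<lambda>p. g (max 0 (fst p))) \<in> borel_measurable borel"
    by (rule borel_measurable_continuous_onI)
  have "layer_density f c g
      = (\<lambda>p. c * (indicator (Omega3 f) p + indicator (Gamma3 f) p * g (max 0 (fst p))))"
    by (auto simp: layer_density_def fun_eq_iff indicator_def Gamma3_def)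
  then show ?thesis by simp
qed

text \<open>
  The weight \<open>a\<close> of a curve measure is taken with respect to \<open>dx\<close>, whereas the surface measure of the
  body has the density \<open>f x * sqrt (1 + (f' x)\<^sup>2)\<close> with respect to \<open>dx d\<theta>\<close>. Their quotient is \<open>g\<close>.
\<close>

lemma axisym_eq_density_mu_bar:
  assumes f: "continuous_on {0..} f" and f': "continuous_on {0..} f'" and g: "continuous_on {0..} g"
    and f_pos: "\<And>x. 0 \<le> x \<Longrightarrow> 0 \<le> f x" and g_pos: "\<And>x. 0 \<le> x \<Longrightarrow> 0 \<le> g x" and c: "0 \<le> c"
    and a: "\<And>x. 0 \<le> x \<Longrightarrow> a x = g x * (f x * sqrt (1 + (f' x)\<^sup>2))"
  shows "axisym (scale_measure (ennreal c) (plus_measure (restr_measure L2_as (Omega_as f)) (curve_measure f a)))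
       = density (mu_bar f f') (\<lambda>p. ennreal (layer_density f c g p))"
proof (rule measure_eqI)
  let ?N = "plus_measure (restr_measure L2_as (Omega_as f)) (curve_measure f a)"
  show "sets (axisym (scale_measure (ennreal c) ?N)) = sets (density (mu_bar f f') (\<lambda>p. ennreal (layer_density f c g p)))"
    by (simp add: axisym_def)
  fix A assume "A \<in> sets (axisym (scale_measure (ennreal c) ?N))"
  then have A: "A \<in> sets borel" by (simp add: axisym_def)
  have a_cont: "continuous_on {0..} a"
  proof -
    have "continuous_on {0..} (\<lambda>x. g x * (f x * sqrt (1 + (f' x)\<^sup>2)))"
      using f f' g by (intro continuous_intros)
    then show ?thesis by (rule continuous_on_eq) (simp add: a)
  qed
  have meas: "(\<lambda>p. ennreal (layer_density f c g p)) \<in> borel_measurable borel"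
    using borel_measurable_layer_density[OF f g] by measurable
  let ?P = "\<lambda>p. \<integral>\<^sup>+\<theta>. indicator {-pi..pi} \<theta> * indicator A (fst p, snd p * cos \<theta>, snd p * sin \<theta>) \<partial>lborel :: ennreal"
  have P: "?P \<in> borel_measurable borel"
    by (rule measurable_circle_integral) (use A in measurable)
  have P': "?P \<in> borel_measurable ?N" "?P \<in> borel_measurable (restr_measure L2_as (Omega_as f))"
    using P by (simp_all cong: measurable_cong_sets)
  have "emeasure (axisym (scale_measure (ennreal c) ?N)) A = (\<integral>\<^sup>+p. indicator A p \<partial>axisym (scale_measure (ennreal c) ?N))"
    using A by (simp add: axisym_def)
  also have "\<dots> = (\<integral>\<^sup>+p. ?P p \<partial>scale_measure (ennreal c) ?N)"
    using A by (intro nn_integral_axisym) auto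
  also have "\<dots> = ennreal c * ((\<integral>\<^sup>+p. ?P p \<partial>restr_measure L2_as (Omega_as f)) + (\<integral>\<^sup>+p. ?P p \<partial>curve_measure f a))"
    using P' by (simp add: nn_integral_scale_measure nn_integral_plus_measure)
  also have "(\<integral>\<^sup>+p. ?P p \<partial>restr_measure L2_as (Omega_as f)) = (\<integral>\<^sup>+p. indicator (Omega3 f) p * indicator A p \<partial>lborel)"
    using A by (intro nn_integral_axisym_Omega_as[OF f f_pos]) auto
  also have "(\<integral>\<^sup>+p. ?P p \<partial>curve_measure f a) = (\<integral>\<^sup>+x. indicator {0..} x * (ennreal (a x) * ?P (x, f x)) \<partial>lborel)"
    by (rule nn_integral_curve_measure[OF f a_cont P])
  finally have lhs: "emeasure (axisym (scale_measure (ennreal c) ?N)) A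
    = ennreal c * (\<integral>\<^sup>+p. indicator (Omega3 f) p * indicator A p \<partial>lborel)
      + ennreal c * (\<integral>\<^sup>+x. indicator {0..} x * (ennreal (a x) * ?P (x, f x)) \<partial>lborel)"
    by (simp add: distrib_left)
  have "emeasure (density (mu_bar f f') (\<lambda>p. ennreal (layer_density f c g p))) A
      = (\<integral>\<^sup>+p. ennreal (layer_density f c g p) * indicator A p \<partial>mu_bar f f')"
    using meas A by (intro emeasure_density) (simp_all cong: measurable_cong_sets)
  also have "\<dots> = (\<integral>\<^sup>+p. indicator (Omega3 f) p * (ennreal (layer_density f c g p) * indicator A p) \<partial>lborel)
         + (\<integral>\<^sup>+s. indicator {0..} s * (ennreal (f s * sqrt (1 + (f' s)\<^sup>2))
            * (\<integral>\<^sup>+\<theta>. indicator {-pi..pi} \<theta>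
                * (ennreal (layer_density f c g (s, f s * cos \<theta>, f s * sin \<theta>))
                   * indicator A (s, f s * cos \<theta>, f s * sin \<theta>)) \<partial>lborel)) \<partial>lborel)"
    using meas A by (intro nn_integral_mu_bar[OF f f' f_pos]) auto
  also have "(\<integral>\<^sup>+p. indicator (Omega3 f) p * (ennreal (layer_density f c g p) * indicator A p) \<partial>lborel)
      = (\<integral>\<^sup>+p. ennreal c * (indicator (Omega3 f) p * indicator A p) \<partial>lborel)"
    by (intro nn_integral_cong) (auto simp: indicator_def layer_density_Omega3)
  also have "\<dots> = ennreal c * (\<integral>\<^sup>+p. indicator (Omega3 f) p * indicator A p \<partial>lborel)"
    using A sets_Omega3_Gamma3(1)[OF f] by (intro nn_integral_cmult) simp
  also have "(\<integral>\<^sup>+s. indicator {0..} s * (ennreal (f s * sqrt (1 + (f' s)\<^sup>2))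
            * (\<integral>\<^sup>+\<theta>. indicator {-pi..pi} \<theta>
                * (ennreal (layer_density f c g (s, f s * cos \<theta>, f s * sin \<theta>))
                   * indicator A (s, f s * cos \<theta>, f s * sin \<theta>)) \<partial>lborel)) \<partial>lborel)
      = (\<integral>\<^sup>+x. ennreal c * (indicator {0..} x * (ennreal (a x) * ?P (x, f x))) \<partial>lborel)"
  proof (rule nn_integral_cong)
    fix s :: real
    show "indicator {0..} s * (ennreal (f s * sqrt (1 + (f' s)\<^sup>2))
            * (\<integral>\<^sup>+\<theta>. indicator {-pi..pi} \<theta>
                * (ennreal (layer_density f c g (s, f s * cos \<theta>, f s * sin \<theta>))
                   * indicator A (s, f s * cos \<theta>, f s * sin \<theta>)) \<partial>lborel))
        = ennreal c * (indicator {0..} s * (ennreal (a s) * ?P (s, f s)))"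
    proof (cases "0 \<le> s")
      case True
      have "(s, f s * cos \<theta>, f s * sin \<theta>) \<in> Gamma3 f" for \<theta>
        using True by (simp add: Gamma3_def power_mult_distrib distrib_left[symmetric])
      then have "layer_density f c g (s, f s * cos \<theta>, f s * sin \<theta>) = c * g s" for \<theta>
        by (simp add: layer_density_Gamma3)
      then have "(\<integral>\<^sup>+\<theta>. indicator {-pi..pi} \<theta>
                * (ennreal (layer_density f c g (s, f s * cos \<theta>, f s * sin \<theta>))
                   * indicator A (s, f s * cos \<theta>, f s * sin \<theta>)) \<partial>lborel)
          = (\<integral>\<^sup>+\<theta>. ennreal (c * g s) * (indicator {-pi..pi} \<theta> * indicator A (s, f s * cos \<theta>, f s * sin \<theta>)) \<partial>lborel)"
        by (simp add: mult.left_commute)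
      also have "\<dots> = ennreal (c * g s) * ?P (s, f s)"
      proof -
        have "(\<lambda>\<theta>. (s, f s * cos \<theta>, f s * sin \<theta>)) \<in> borel_measurable borel"
          by (intro borel_measurable_continuous_onI continuous_intros)
        from measurable_compose[OF this borel_measurable_indicator[OF A]]
        have "(\<lambda>\<theta>. indicator A (s, f s * cos \<theta>, f s * sin \<theta>) :: ennreal) \<in> borel_measurable borel" .
        then show ?thesis by (subst nn_integral_cmult) simp_all
      qed
      finally show ?thesis
        using True c g_pos[OF True] f_pos[OF True]
        by (simp add: a ennreal_mult ac_simps)
    qed simp
  qed
  also have "\<dots> = ennreal c * (\<integral>\<^sup>+x. indicator {0..} x * (ennreal (a x) * ?P (x, f x)) \<partial>lborel)"
  proof -
    let ?h = "\<lambda>x. ennreal (a x) * ?P (x, f x)"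
    have curve: "(\<lambda>x. (x, f x)) \<in> borel_measurable (restrict_space lborel {0..})"
      by (intro measurable_restrict_lborel continuous_intros f)
    have "?h \<in> borel_measurable (restrict_space lborel {0..})"
      using measurable_compose[OF curve P] measurable_restrict_lborel[OF a_cont] by simp
    then have "(\<lambda>x. indicator {0..} x * ?h x) \<in> borel_measurable lborel"
      by (subst (asm) borel_measurable_restrict_space_iff_ennreal) (simp_all add: mult.commute)
    then show ?thesis by (rule nn_integral_cmult)
  qed
  finally show "emeasure (axisym (scale_measure (ennreal c) ?N)) A
      = emeasure (density (mu_bar f f') (\<lambda>p. ennreal (layer_density f c g p))) A"
    using lhs by simp
qed

lemma RN_version_layer_density:
  assumes f: "continuous_on {0..} f" and f': "continuous_on {0..} f'" and g: "continuous_on {0..} g"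
    and f_pos: "\<And>x. 0 \<le> x \<Longrightarrow> 0 \<le> f x" and g_pos: "\<And>x. 0 \<le> x \<Longrightarrow> 0 \<le> g x" and c: "0 \<le> c"
    and a: "\<And>x. 0 \<le> x \<Longrightarrow> a x = g x * (f x * sqrt (1 + (f' x)\<^sup>2))"
  shows "RN_version (mu_bar f f')
     (axisym (scale_measure (ennreal c) (plus_measure (restr_measure L2_as (Omega_as f)) (curve_measure f a))))
     (Omega3 f) (Gamma3 f) (layer_density f c g)"
proof -
  have eq: "axisym (scale_measure (ennreal c) (plus_measure (restr_measure L2_as (Omega_as f)) (curve_measure f a)))
       = density (mu_bar f f') (\<lambda>p. ennreal (layer_density f c g p))"
    by (rule axisym_eq_density_mu_bar) (fact assms)+
  show ?thesis
    unfolding RN_version_def eq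
  proof (intro conjI allI)
    have m: "layer_density f c g \<in> borel_measurable (mu_bar f f')"
      using borel_measurable_layer_density[OF f g] by (simp cong: measurable_cong_sets)
    then have m': "(\<lambda>p. ennreal (layer_density f c g p)) \<in> borel_measurable (mu_bar f f')"
      by simp
    show "layer_density f c g \<in> borel_measurable (mu_bar f f')" by (rule m)
    show "absolutely_continuous (mu_bar f f') (density (mu_bar f f') (\<lambda>p. ennreal (layer_density f c g p)))"
      using m' by (rule absolutely_continuousI_density)
    show "0 \<le> layer_density f c g p" for p
    proof -
      have "0 \<le> indicator (Gamma3 f) p * g (fst p)"
        by (cases "p \<in> Gamma3 f") (auto simp: Gamma3_def intro: g_pos)
      with c show ?thesis by (simp add: layer_density_def)
    qed
    interpret sigma_finite_measure "mu_bar f f'"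
      by (rule sigma_finite_mu_bar[OF f f' f_pos])
    show "AE p in mu_bar f f'. RN_deriv (mu_bar f f') (density (mu_bar f f') (\<lambda>p. ennreal (layer_density f c g p))) p
        = ennreal (layer_density f c g p)"
      using RN_deriv_unique[OF m' refl] by eventually_elim simp
    show "continuous_on (Omega3 f) (layer_density f c g)"
      using continuous_on_const[of _ c] by (rule continuous_on_eq) (simp add: layer_density_Omega3)
    have "continuous_on (Gamma3 f) (\<lambda>p. g (fst p))"
      by (rule continuous_on_compose2[OF g continuous_on_fst[OF continuous_on_id]]) (auto simp: Gamma3_def)
    then have "continuous_on (Gamma3 f) (\<lambda>p. c * g (fst p))"
      by (intro continuous_intros)
    then show "continuous_on (Gamma3 f) (layer_density f c g)"
      by (rule continuous_on_eq) (simp add: layer_density_Gamma3)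
  qed simp
qed

section \<open>The mass flux integral for small slenderness ratio\<close>

text \<open>
  Continuity on compact intervals is that of an indefinite integral, and continuity on \<open>[0, \<infinity>)\<close> is local.
\<close>

lemma continuous_on_M_tau:
  assumes f: "continuous_on {0..} f" and f': "continuous_on {0..} f'"
  shows "continuous_on {0..} (M_tau \<tau> f f')"
proof -
  have int: "(\<lambda>t. f t * f' t / sqrt (1 + \<tau>\<^sup>2 * (f' t)\<^sup>2)) integrable_on {0..b}" for b
    using f f' by (intro integrable_continuous_real continuous_intros)
      (auto intro: continuous_on_subset simp: add_nonneg_eq_0_iff)
  have "continuous_on {0..b} (M_tau \<tau> f f')" for b
    unfolding M_tau_def[abs_def] by (rule indefinite_integral_continuous_1[OF int])
  then have "continuous (at x within {0..x + 1}) (M_tau \<tau> f f')" if "0 \<le> x" for x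
    using that by (auto simp: continuous_on_eq_continuous_within)
  moreover have "at x within {0..x + 1} = at x within {0..}" if "0 \<le> x" for x :: real
    by (rule at_within_nhd[of _ "{..<x + 1}"]) auto
  ultimately show ?thesis
    by (simp add: continuous_on_eq_continuous_within)
qed


text \<open>
  The regularity and monotonicity that the limits need from a generatrix with vertex at the origin.
\<close>

locale body_profile =
  fixes f f' f'' :: "real \<Rightarrow> real"
  assumes f_deriv: "\<And>x. 0 \<le> x \<Longrightarrow> (f has_real_derivative f' x) (at x within {0..})"
    and f'_deriv: "\<And>x. 0 \<le> x \<Longrightarrow> (f' has_real_derivative f'' x) (at x within {0..})"
    and f''_cont: "continuous_on {0..} f''"
    and f_0: "f 0 = 0"
    and f'_pos: "\<And>x. 0 \<le> x \<Longrightarrow> 0 < f' x"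
begin

lemma f_cont: "continuous_on {0..} f"
  using f_deriv by (auto simp: continuous_on_eq_continuous_within intro: DERIV_continuous)

lemma f'_cont: "continuous_on {0..} f'"
  using f'_deriv by (auto simp: continuous_on_eq_continuous_within intro: DERIV_continuous)

lemmas conts [continuous_intros] =
  f_cont[THEN continuous_on_subset] f'_cont[THEN continuous_on_subset] f''_cont[THEN continuous_on_subset]

lemma f_pos: "0 < x \<Longrightarrow> 0 < f x"
proof -
  assume x: "0 < x"
  have "f 0 < f x"
  proof (rule DERIV_pos_imp_increasing_open[OF x])
    fix t assume t: "0 < t" "t < x"
    then have "at t within {0..} = at t"
      by (intro at_within_interior) simp
    then show "\<exists>y. DERIV f t :> y \<and> 0 < y"
      using f_deriv[of t] f'_pos[of t] t by auto
  qed (intro continuous_intros, auto)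
  then show ?thesis by (simp add: f_0)
qed

lemma f_nonneg: "0 \<le> x \<Longrightarrow> 0 \<le> f x"
  using f_pos[of x] f_0 by (cases "x = 0") auto

lemma integral_derivative:
  assumes "\<And>t. 0 \<le> t \<Longrightarrow> (g has_real_derivative g' t) (at t within {0..})" and "0 \<le> x"
  shows "integral {0..x} g' = g x - g 0"
proof (rule integral_unique, rule fundamental_theorem_of_calculus)
  fix t assume "t \<in> {0..x}"
  then show "(g has_vector_derivative g' t) (at t within {0..x})"
    using assms(1)[of t] DERIV_subset[of g "g' t" t "{0..}" "{0..x}"]
    by (auto simp: has_real_derivative_iff_has_vector_derivative)
qed fact

lemma integral_f_f':
  assumes "0 \<le> x"
  shows "integral {0..x} (\<lambda>t. f t * f' t) = (f x)\<^sup>2 / 2"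
proof -
  have "((\<lambda>t. (f t)\<^sup>2 / 2) has_real_derivative f t * f' t) (at t within {0..})" if "0 \<le> t" for t
    using that by (auto intro!: derivative_eq_intros f_deriv)
  from integral_derivative[OF this assms] show ?thesis by (simp add: f_0)
qed

text \<open>
  Integration by parts. This is where the second derivative enters the limiting axial velocity.
\<close>

lemma integral_f_f'_cubed:
  assumes "0 \<le> x"
  shows "integral {0..x} (\<lambda>t. f t * f' t ^ 3)
       = (f x)\<^sup>2 * (f' x)\<^sup>2 / 2 - integral {0..x} (\<lambda>t. (f t)\<^sup>2 * f' t * f'' t)"
proof -
  have "((\<lambda>t. (f t)\<^sup>2 * (f' t)\<^sup>2 / 2) has_real_derivative f t * f' t ^ 3 + (f t)\<^sup>2 * f' t * f'' t)
      (at t within {0..})" if "0 \<le> t" for t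
    using that
    by (auto intro!: derivative_eq_intros f_deriv f'_deriv simp: power2_eq_square power3_eq_cube algebra_simps)
  from integral_derivative[OF this assms]
  have "integral {0..x} (\<lambda>t. f t * f' t ^ 3 + (f t)\<^sup>2 * f' t * f'' t) = (f x)\<^sup>2 * (f' x)\<^sup>2 / 2"
    by (simp add: f_0)
  moreover have "integral {0..x} (\<lambda>t. f t * f' t ^ 3 + (f t)\<^sup>2 * f' t * f'' t)
      = integral {0..x} (\<lambda>t. f t * f' t ^ 3) + integral {0..x} (\<lambda>t. (f t)\<^sup>2 * f' t * f'' t)"
    by (intro integral_add integrable_continuous_real continuous_intros) auto
  ultimately show ?thesis by simp
qed

text \<open>The arc length element of the generatrix \<open>\<tau> * f\<close>.\<close>

definition stretch :: "real \<Rightarrow> real \<Rightarrow> real" where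
  "stretch \<tau> x = sqrt (1 + \<tau>\<^sup>2 * (f' x)\<^sup>2)"

lemma stretch_ge_1: "1 \<le> stretch \<tau> x"
  by (simp add: stretch_def)

lemma stretch_sq: "(stretch \<tau> x)\<^sup>2 = 1 + \<tau>\<^sup>2 * (f' x)\<^sup>2"
  by (simp add: stretch_def)

lemma continuous_on_stretch [continuous_intros]: "A \<subseteq> {0..} \<Longrightarrow> continuous_on A (stretch \<tau>)"
  unfolding stretch_def by (intro continuous_intros)

lemma tendsto_stretch: "((\<lambda>\<tau>. stretch \<tau> x) \<longlongrightarrow> 1) (at_right 0)"
  unfolding stretch_def by (rule tendsto_eq_intros refl | simp)+

text \<open>
  The amount, in units of \<open>\<tau>\<^sup>2\<close>, by which \<open>M_tau\<close> falls short of its limit \<open>f\<^sup>2 / 2\<close>. It comes from the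
  exact identity \<open>1 - 1 / s = \<tau>\<^sup>2 f'\<^sup>2 / (s (1 + s))\<close> for \<open>s = stretch \<tau> t\<close>, so that no Taylor remainder
  has to be estimated.
\<close>

definition defect :: "real \<Rightarrow> real \<Rightarrow> real" where
  "defect \<tau> x = integral {0..x} (\<lambda>t. f t * f' t ^ 3 / (stretch \<tau> t * (1 + stretch \<tau> t)))"

lemma stretch_nz: "stretch \<tau> x \<noteq> 0" "1 + stretch \<tau> x \<noteq> 0" "0 < stretch \<tau> x"
  using stretch_ge_1[of \<tau> x] by auto

lemma M_tau_eq_defect:
  assumes "0 \<le> x"
  shows "M_tau \<tau> f f' x = (f x)\<^sup>2 / 2 - \<tau>\<^sup>2 * defect \<tau> x"
proof -
  have pt: "f t * f' t / stretch \<tau> t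
      = f t * f' t - \<tau>\<^sup>2 * (f t * f' t ^ 3 / (stretch \<tau> t * (1 + stretch \<tau> t)))" for t
  proof -
    have "f t * f' t - f t * f' t / stretch \<tau> t = f t * f' t * ((stretch \<tau> t)\<^sup>2 - 1) / (stretch \<tau> t * (1 + stretch \<tau> t))"
      using stretch_nz by (simp add: divide_simps power2_eq_square) (simp add: algebra_simps)
    also have "\<dots> = \<tau>\<^sup>2 * (f t * f' t ^ 3 / (stretch \<tau> t * (1 + stretch \<tau> t)))"
      unfolding stretch_sq by (simp add: power2_eq_square power3_eq_cube ac_simps)
    finally show ?thesis by simp
  qed
  have "M_tau \<tau> f f' x = integral {0..x} (\<lambda>t. f t * f' t - \<tau>\<^sup>2 * (f t * f' t ^ 3 / (stretch \<tau> t * (1 + stretch \<tau> t))))"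
    unfolding M_tau_def pt[symmetric] by (simp add: stretch_def)
  also have "\<dots> = integral {0..x} (\<lambda>t. f t * f' t) - \<tau>\<^sup>2 * defect \<tau> x"
    unfolding defect_def
    by (subst integral_diff)
       (auto intro!: integrable_continuous_real continuous_intros simp: stretch_nz simp flip: integral_mult_right)
  finally show ?thesis using assms by (simp add: integral_f_f')
qed

text \<open>
  The integrand of the defect is jointly continuous in \<open>\<tau>\<close> and \<open>t\<close>, up to and including \<open>\<tau> = 0\<close>.
\<close>

lemma tendsto_defect:
  assumes "0 \<le> x"
  shows "((\<lambda>\<tau>. defect \<tau> x) \<longlongrightarrow>
      ((f x)\<^sup>2 * (f' x)\<^sup>2 / 2 - integral {0..x} (\<lambda>t. (f t)\<^sup>2 * f' t * f'' t)) / 2) (at_right 0)"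
proof -
  have c: "continuous_on (UNIV \<times> {0..x}) (\<lambda>p. f (snd p))" "continuous_on (UNIV \<times> {0..x}) (\<lambda>p. f' (snd p))"
    by (rule continuous_on_compose2[OF f_cont] continuous_on_compose2[OF f'_cont], intro continuous_intros, force)+
  have "continuous_on UNIV (\<lambda>\<tau>. integral (cbox 0 x) (\<lambda>t. f t * f' t ^ 3 / (stretch \<tau> t * (1 + stretch \<tau> t))))"
  proof (rule integral_continuous_on_param)
    show "continuous_on (UNIV \<times> cbox 0 x) (\<lambda>(\<tau>, t). f t * f' t ^ 3 / (stretch \<tau> t * (1 + stretch \<tau> t)))"
      using stretch_nz unfolding case_prod_beta stretch_def
      by (auto intro!: continuous_intros c)
  qed
  then have "continuous_on UNIV (\<lambda>\<tau>. defect \<tau> x)" by (simp add: defect_def)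
  then have "((\<lambda>\<tau>. defect \<tau> x) \<longlongrightarrow> defect 0 x) (at_right 0)"
    by (auto simp: continuous_on_def intro: tendsto_within_subset)
  moreover have "defect 0 x = integral {0..x} (\<lambda>t. f t * f' t ^ 3) / 2"
    by (simp add: defect_def stretch_def)
  ultimately show ?thesis using assms by (simp add: integral_f_f'_cubed)
qed

lemma tendsto_M_tau: "0 \<le> x \<Longrightarrow> ((\<lambda>\<tau>. M_tau \<tau> f f' x) \<longlongrightarrow> (f x)\<^sup>2 / 2) (at_right 0)"
  unfolding M_tau_eq_defect by (rule tendsto_eq_intros tendsto_defect refl | simp)+

lemma M_tau_stretch: "M_tau \<tau> f f' x = integral {0..x} (\<lambda>t. f t * f' t / stretch \<tau> t)"
  by (simp add: M_tau_def stretch_def)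

lemma M_tau_le: "0 \<le> x \<Longrightarrow> M_tau \<tau> f f' x \<le> (f x)\<^sup>2 / 2"
proof -
  assume x: "0 \<le> x"
  have "0 \<le> defect \<tau> x"
    unfolding defect_def using stretch_nz(3)[of \<tau>]
    by (intro integral_nonneg integrable_continuous_real continuous_intros)
       (auto intro!: divide_nonneg_nonneg mult_nonneg_nonneg f_nonneg less_imp_le[OF f'_pos] zero_le_power
          simp: stretch_nz less_imp_le add_nonneg_nonneg)
  then show ?thesis using x by (simp add: M_tau_eq_defect)
qed

lemma M_tau_ge:
  assumes "0 \<le> x" and S: "\<And>t. 0 \<le> t \<Longrightarrow> t \<le> x \<Longrightarrow> stretch \<tau> t \<le> S"
  shows "(f x)\<^sup>2 / (2 * S) \<le> M_tau \<tau> f f' x"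
proof -
  have "S \<noteq> 0" using S[of 0] assms(1) stretch_ge_1[of \<tau> 0] by auto
  have "integral {0..x} (\<lambda>t. f t * f' t / S) \<le> integral {0..x} (\<lambda>t. f t * f' t / stretch \<tau> t)"
  proof (rule integral_le)
    fix t assume t: "t \<in> {0..x}"
    then show "f t * f' t / S \<le> f t * f' t / stretch \<tau> t"
      using S[of t] stretch_nz(3)[of \<tau> t] f_nonneg[of t] f'_pos[of t]
      by (intro divide_left_mono mult_nonneg_nonneg mult_pos_pos) auto
  qed (use \<open>S \<noteq> 0\<close> in \<open>auto intro!: integrable_continuous_real continuous_intros simp: stretch_nz\<close>)
  then show ?thesis using assms(1)
    by (simp add: M_tau_stretch integral_f_f')
qed

lemma M_tau_pos:
  assumes "0 < x"
  shows "0 < M_tau \<tau> f f' x"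
proof -
  have "compact (stretch \<tau> ` {0..x})"
    by (intro compact_continuous_image continuous_intros) auto
  then obtain S where S: "\<And>t. t \<in> {0..x} \<Longrightarrow> stretch \<tau> t \<le> S"
    using compact_imp_bounded bounded_iff by (metis abs_le_D1 image_eqI real_norm_def)
  have "0 < (f x)\<^sup>2 / (2 * S)"
    using S[of 0] stretch_nz(3)[of \<tau> 0] f_pos[OF assms] assms by auto
  also have "\<dots> \<le> M_tau \<tau> f f' x"
    by (rule M_tau_ge) (use assms S in auto)
  finally show ?thesis .
qed

lemma M_tau_nonneg: "0 \<le> x \<Longrightarrow> 0 \<le> M_tau \<tau> f f' x"
  using M_tau_pos[of x \<tau>] by (cases "x = 0") (auto simp: M_tau_def)

end

section \<open>Convergence of the scaled solution\<close>

lemma rad_Gamma3: "(x, y, z) \<in> Gamma3 f \<Longrightarrow> 0 \<le> f x \<Longrightarrow> rad y z = f x"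
  by (auto simp: Gamma3_def rad_def)

lemma rad_Omega3: "(x, y, z) \<in> Omega3 f \<Longrightarrow> f x < rad y z"
  by (auto simp: Omega3_def rad_def intro: real_less_rsqrt)

text \<open>
  To be \<open>o(1)\<close>, it suffices to agree eventually with the difference of a convergent function and
  its limit.
\<close>

lemma smallo_1I:
  fixes f g :: "'a \<Rightarrow> real"
  assumes "(f \<longlongrightarrow> c) F" "\<forall>\<^sub>F x in F. g x = f x - c"
  shows "g \<in> o[F](\<lambda>_. 1)"
proof (rule smalloI_tendsto)
  have "((\<lambda>x. f x - c) \<longlongrightarrow> 0) F"
    using assms(1) LIM_zero by blast
  then show "((\<lambda>x. g x / 1) \<longlongrightarrow> 0) F"
    using assms(2) by (simp add: tendsto_cong)
qed simp

context body_profile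
begin

subsection \<open>Velocity and enthalpy\<close>

text \<open>
  The only limit that needs a second-order expansion: the deviation of the axial velocity from
  \<open>u_inf\<close> is divided by \<open>\<tau>\<^sup>2\<close>.
\<close>

lemma tendsto_surface_u:
  assumes x: "0 < x"
  shows "((\<lambda>\<tau>. (2 * M_tau \<tau> f f' x / ((f x)\<^sup>2 * stretch \<tau> x) - 1) / \<tau>\<^sup>2) \<longlongrightarrow>
     - (f' x)\<^sup>2 + integral {0..x} (\<lambda>t. (f t)\<^sup>2 * f' t * f'' t) / (f x)\<^sup>2) (at_right 0)"
proof -
  let ?I = "integral {0..x} (\<lambda>t. (f t)\<^sup>2 * f' t * f'' t)"
  have fx: "f x \<noteq> 0" using f_pos[OF x] by simp
  have ev: "\<forall>\<^sub>F \<tau> in at_right 0. (2 * M_tau \<tau> f f' x / ((f x)\<^sup>2 * stretch \<tau> x) - 1) / \<tau>\<^sup>2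
     = - (2 * defect \<tau> x / (f x)\<^sup>2 + (f' x)\<^sup>2 / (1 + stretch \<tau> x)) / stretch \<tau> x"
    using eventually_at_right_less[of "0::real"]
  proof eventually_elim
    case (elim \<tau>)
    have "1 - stretch \<tau> x = - (\<tau>\<^sup>2 * (f' x)\<^sup>2) / (1 + stretch \<tau> x)"
      using stretch_sq[of \<tau> x] stretch_nz[of \<tau> x] by (simp add: field_simps power2_eq_square)
    then have s: "(1 - stretch \<tau> x) / \<tau>\<^sup>2 = - (f' x)\<^sup>2 / (1 + stretch \<tau> x)"
      using elim by simp
    have "2 * M_tau \<tau> f f' x / ((f x)\<^sup>2 * stretch \<tau> x) - 1
        = (- (2 * defect \<tau> x / (f x)\<^sup>2) * \<tau>\<^sup>2 + (1 - stretch \<tau> x)) / stretch \<tau> x"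
      using x fx stretch_nz[of \<tau> x] by (simp add: M_tau_eq_defect field_simps)
    then have "(2 * M_tau \<tau> f f' x / ((f x)\<^sup>2 * stretch \<tau> x) - 1) / \<tau>\<^sup>2
        = (- (2 * defect \<tau> x / (f x)\<^sup>2) * \<tau>\<^sup>2 / \<tau>\<^sup>2 + (1 - stretch \<tau> x) / \<tau>\<^sup>2) / stretch \<tau> x"
      by (simp only: add_divide_distrib divide_divide_eq_left mult.commute)
    then show ?case using elim unfolding s by simp
  qed
  have "((\<lambda>\<tau>. - (2 * defect \<tau> x / (f x)\<^sup>2 + (f' x)\<^sup>2 / (1 + stretch \<tau> x)) / stretch \<tau> x) \<longlongrightarrow>
      - (2 * (((f x)\<^sup>2 * (f' x)\<^sup>2 / 2 - ?I) / 2) / (f x)\<^sup>2 + (f' x)\<^sup>2 / (1 + 1)) / 1) (at_right 0)"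
    using x fx by (intro tendsto_intros tendsto_defect tendsto_stretch) auto
  also have "- (2 * (((f x)\<^sup>2 * (f' x)\<^sup>2 / 2 - ?I) / 2) / (f x)\<^sup>2 + (f' x)\<^sup>2 / (1 + 1)) / 1
      = - (f' x)\<^sup>2 + ?I / (f x)\<^sup>2"
    using fx by (simp add: field_simps)
  finally show ?thesis using ev by (simp add: tendsto_cong)
qed

lemma tendsto_surface_q:
  assumes x: "0 < x"
  shows "((\<lambda>\<tau>. 2 * f' x * M_tau \<tau> f f' x / ((f x)\<^sup>2 * stretch \<tau> x)) \<longlongrightarrow> f' x) (at_right 0)"
proof -
  have "((\<lambda>\<tau>. 2 * f' x * M_tau \<tau> f f' x / ((f x)\<^sup>2 * stretch \<tau> x)) \<longlongrightarrow>
      2 * f' x * ((f x)\<^sup>2 / 2) / ((f x)\<^sup>2 * 1)) (at_right 0)"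
    using x f_pos[OF x] by (intro tendsto_intros tendsto_M_tau tendsto_stretch) auto
  then show ?thesis using f_pos[OF x] by simp
qed

text \<open>
  The point of the physical half-plane that corresponds to a scaled point lies outside or on the slender
  body exactly if the scaled point lies outside or on the scaled body. The vertex is the only point of
  the surface with \<open>x = 0\<close>.
\<close>

lemma physical_point:
  assumes p: "(x, y, z) \<in> (Omega3 f \<union> Gamma3 f) - {(0, 0, 0)}" and \<tau>: "0 < \<tau>"
  shows "0 \<le> x"
    and "(x, \<tau> * rad y z) \<in> Omega_as (\<lambda>x. \<tau> * f x) \<longleftrightarrow> (x, y, z) \<in> Omega3 f"
    and "(x, \<tau> * rad y z) \<in> Gamma_as (\<lambda>x. \<tau> * f x) \<longleftrightarrow> (x, y, z) \<in> Gamma3 f"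
    and "(x, rad y z) \<in> Omega_as f \<longleftrightarrow> (x, y, z) \<in> Omega3 f"
    and "(x, rad y z) \<in> Gamma_as f \<longleftrightarrow> (x, y, z) \<in> Gamma3 f"
    and "(x, y, z) \<in> Omega3 f \<longleftrightarrow> (x, y, z) \<notin> Gamma3 f"
    and "(x, y, z) \<in> Gamma3 f \<Longrightarrow> 0 < x"
proof -
  show x: "0 \<le> x" using p by (auto simp: Omega3_def Gamma3_def)
  have cases: "(x, y, z) \<in> Omega3 f \<and> (x, y, z) \<notin> Gamma3 f \<and> f x < rad y z
      \<or> (x, y, z) \<notin> Omega3 f \<and> (x, y, z) \<in> Gamma3 f \<and> rad y z = f x"
    using p rad_Omega3[of x y z f] rad_Gamma3[of x y z f] f_nonneg[OF x]
    by (auto simp: Omega3_def Gamma3_def)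
  show "(x, \<tau> * rad y z) \<in> Omega_as (\<lambda>x. \<tau> * f x) \<longleftrightarrow> (x, y, z) \<in> Omega3 f"
    "(x, \<tau> * rad y z) \<in> Gamma_as (\<lambda>x. \<tau> * f x) \<longleftrightarrow> (x, y, z) \<in> Gamma3 f"
    "(x, rad y z) \<in> Omega_as f \<longleftrightarrow> (x, y, z) \<in> Omega3 f"
    "(x, rad y z) \<in> Gamma_as f \<longleftrightarrow> (x, y, z) \<in> Gamma3 f"
    "(x, y, z) \<in> Omega3 f \<longleftrightarrow> (x, y, z) \<notin> Gamma3 f"
    using cases x \<tau> by (auto simp: Omega_as_def Gamma_as_def)
  show "0 < x" if "(x, y, z) \<in> Gamma3 f"
    using that x p f_0 by (cases "x = 0") (auto simp: Gamma3_def sum_power2_eq_zero_iff)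
qed

lemma u_scaled_asymp:
  assumes u: "0 < u_inf" and p: "p \<in> (Omega3 f \<union> Gamma3 f) - {(0, 0, 0)}"
  shows "(\<lambda>\<tau>. u_scaled u_inf \<tau> f f' p - u_B f f' f'' p) \<in> o[at_right 0](\<lambda>_. 1)"
proof -
  obtain x y z where pq: "p = (x, y, z)" by (cases p)
  note pt = physical_point[OF p[unfolded pq]]
  show ?thesis
  proof (cases "(x, y, z) \<in> Gamma3 f")
    case True
    show ?thesis
    proof (rule smallo_1I[OF tendsto_surface_u[OF pt(7)[OF zero_less_one True]]])
      show "\<forall>\<^sub>F \<tau> in at_right 0. u_scaled u_inf \<tau> f f' p - u_B f f' f'' p
          = (2 * M_tau \<tau> f f' x / ((f x)\<^sup>2 * stretch \<tau> x) - 1) / \<tau>\<^sup>2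
            - (- (f' x)\<^sup>2 + integral {0..x} (\<lambda>t. (f t)\<^sup>2 * f' t * f'' t) / (f x)\<^sup>2)"
        using eventually_at_right_less[of "0::real"]
      proof eventually_elim
        case (elim \<tau>)
        let ?m = "2 * M_tau \<tau> f f' x / ((f x)\<^sup>2 * stretch \<tau> x)"
        have "(2 * u_inf * M_tau \<tau> f f' x / ((f x)\<^sup>2 * stretch \<tau> x) - u_inf) / (u_inf * \<tau>\<^sup>2)
            = (u_inf * (?m - 1)) / (u_inf * \<tau>\<^sup>2)"
          by (simp add: algebra_simps)
        also have "\<dots> = (?m - 1) / \<tau>\<^sup>2" using u by simp
        finally show ?case
          using True pt(2-6)[OF elim] by (simp add: pq u_scaled_def u_A_def u_B_def u_B_as_def stretch_def)
      qed
    qed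
  next
    case False
    show ?thesis
    proof (rule smallo_1I[OF tendsto_const[of 0]])
      show "\<forall>\<^sub>F \<tau> in at_right 0. u_scaled u_inf \<tau> f f' p - u_B f f' f'' p = 0 - 0"
        using eventually_at_right_less[of "0::real"]
        by eventually_elim (use False pt(2-6) in \<open>simp add: pq u_scaled_def u_A_def u_B_def u_B_as_def\<close>)
    qed
  qed
qed

text \<open>
  With \<open>k = y / rad y z\<close> and \<open>k = z / rad y z\<close> this is the statement for the two transversal velocity
  components.
\<close>

lemma q_scaled_asymp:
  assumes u: "0 < u_inf" and p: "(x, y, z) \<in> (Omega3 f \<union> Gamma3 f) - {(0, 0, 0)}"
  shows "(\<lambda>\<tau>. q_A u_inf \<tau> f f' (x, \<tau> * rad y z) / (u_inf * \<tau>) * k - q_B_as f f' (x, rad y z) * k)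
           \<in> o[at_right 0](\<lambda>_. 1)"
proof -
  note pt = physical_point[OF p]
  show ?thesis
  proof (cases "(x, y, z) \<in> Gamma3 f")
    case True
    show ?thesis
    proof (rule smallo_1I[OF tendsto_mult_right[OF tendsto_surface_q[OF pt(7)[OF zero_less_one True]]]])
      show "\<forall>\<^sub>F \<tau> in at_right 0.
          q_A u_inf \<tau> f f' (x, \<tau> * rad y z) / (u_inf * \<tau>) * k - q_B_as f f' (x, rad y z) * k
          = 2 * f' x * M_tau \<tau> f f' x / ((f x)\<^sup>2 * stretch \<tau> x) * k - f' x * k"
        using eventually_at_right_less[of "0::real"]
        by eventually_elim (use True u pt(2-6) in \<open>simp add: q_A_def q_B_as_def stretch_def\<close>)
    qed
  next
    case False
    show ?thesis
    proof (rule smallo_1I[OF tendsto_const[of 0]])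
      show "\<forall>\<^sub>F \<tau> in at_right 0.
          q_A u_inf \<tau> f f' (x, \<tau> * rad y z) / (u_inf * \<tau>) * k - q_B_as f f' (x, rad y z) * k = 0 - 0"
        using eventually_at_right_less[of "0::real"]
        by eventually_elim (use False pt(2-6) in \<open>simp add: q_A_def q_B_as_def\<close>)
    qed
  qed
qed

lemma E_scaled_asymp:
  assumes u: "0 < u_inf" and p: "p \<in> (Omega3 f \<union> Gamma3 f) - {(0, 0, 0)}"
  shows "(\<lambda>\<tau>. E_scaled \<gamma> K u_inf \<tau> f p - E_B \<gamma> K f p) \<in> o[at_right 0](\<lambda>_. 1)"
proof -
  obtain x y z where pq: "p = (x, y, z)" by (cases p)
  note pt = physical_point[OF p[unfolded pq]]
  have E: "(2 * E_inf \<gamma> K u_inf \<tau> - u_inf\<^sup>2) / (u_inf\<^sup>2 * \<tau>\<^sup>2) = E_bar_inf \<gamma> K" if "0 < \<tau>" for \<tau>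
  proof -
    have "2 * E_inf \<gamma> K u_inf \<tau> - u_inf\<^sup>2 = u_inf\<^sup>2 * \<tau>\<^sup>2 * E_bar_inf \<gamma> K"
      by (simp add: E_inf_def E_bar_inf_def algebra_simps)
    then show ?thesis using u that by simp
  qed
  show ?thesis
  proof (rule smallo_1I[OF tendsto_const[of 0]])
    show "\<forall>\<^sub>F \<tau> in at_right 0. E_scaled \<gamma> K u_inf \<tau> f p - E_B \<gamma> K f p = 0 - 0"
      using eventually_at_right_less[of "0::real"]
    proof eventually_elim
      case (elim \<tau>)
      show ?case
        using pt(2-6)[OF elim] E[OF elim]
        by (cases "(x, y, z) \<in> Gamma3 f") (simp_all add: pq E_scaled_def E_A_def E_B_def E_B_as_def)
    qed
  qed
qed

subsection \<open>Densities of the mass measures\<close>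

text \<open>
  The surface density of the scaled mass measure with respect to surface measure, divided by \<open>\<tau>\<close>. At
  \<open>x = 0\<close> it reads \<open>0 / 0 = 0\<close>, which is its limit at the vertex.
\<close>

definition surface_weight :: "real \<Rightarrow> real \<Rightarrow> real" where
  "surface_weight \<tau> x = f x ^ 3 * stretch \<tau> x / (4 * M_tau \<tau> f f' x * sqrt (1 + (f' x)\<^sup>2))"

lemma surface_weight_nonneg: "0 \<le> x \<Longrightarrow> 0 \<le> surface_weight \<tau> x"
  using f_nonneg[of x] M_tau_nonneg[of x \<tau>] stretch_nz(3)[of \<tau> x]
  by (simp add: surface_weight_def)

lemma sqrt_slope_nz: "sqrt (1 + (f' x)\<^sup>2) \<noteq> 0"
  by (simp add: add_nonneg_eq_0_iff)

lemma continuous_on_surface_weight: "continuous_on {0..} (surface_weight \<tau>)"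
  unfolding continuous_on_eq_continuous_within
proof
  fix x :: real assume "x \<in> {0..}"
  then consider "0 < x" | "x = 0" by fastforce
  then show "continuous (at x within {0..}) (surface_weight \<tau>)"
  proof cases
    case 1
    have "continuous_on {0<..} (surface_weight \<tau>)"
      unfolding surface_weight_def
      by (intro continuous_intros continuous_on_subset[OF continuous_on_M_tau[OF f_cont f'_cont]])
         (auto simp: M_tau_pos[THEN less_imp_neq, symmetric] sqrt_slope_nz simp del: real_sqrt_eq_zero_cancel_iff)
    then have "isCont (surface_weight \<tau>) x"
      using 1 by (simp add: continuous_on_eq_continuous_at)
    then show ?thesis by (rule continuous_at_imp_continuous_at_within)
  next
    case 2
    \<comment> \<open>Near the vertex the quotient \<open>f ^ 3 / M_tau\<close> is of the order of \<open>f\<close>.\<close>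
    have "compact (stretch \<tau> ` {0..1})"
      by (intro compact_continuous_image continuous_intros) auto
    then obtain S where S: "\<And>t. t \<in> {0..1} \<Longrightarrow> stretch \<tau> t \<le> S"
      using compact_imp_bounded bounded_iff by (metis abs_le_D1 image_eqI real_norm_def)
    have bound: "norm (surface_weight \<tau> x) \<le> S\<^sup>2 / 2 * f x" if x: "0 < x" "x \<le> 1" for x
    proof -
      have M: "(f x)\<^sup>2 / (2 * S) \<le> M_tau \<tau> f f' x"
        by (rule M_tau_ge) (use x S in auto)
      have f: "0 < f x" using x by (simp add: f_pos)
      have S1: "1 \<le> S" using S[of x] x stretch_ge_1[of \<tau> x] by auto
      have "surface_weight \<tau> x \<le> f x ^ 3 * S / (4 * ((f x)\<^sup>2 / (2 * S)) * 1)"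
        unfolding surface_weight_def
        using f x S[of x] S1 M M_tau_pos[of x \<tau>] stretch_nz(3)[of \<tau> x]
        by (intro frac_le mult_mono mult_nonneg_nonneg mult_pos_pos divide_pos_pos) auto
      also have "\<dots> = S\<^sup>2 / 2 * f x"
        using f S1 by (simp add: field_simps power2_eq_square power3_eq_cube)
      finally show ?thesis using x by (simp add: surface_weight_nonneg)
    qed
    have "((\<lambda>x. S\<^sup>2 / 2 * f x) \<longlongrightarrow> S\<^sup>2 / 2 * f 0) (at 0 within {0..})"
      using f_cont by (intro tendsto_intros) (auto simp: continuous_on_def)
    then have lim: "((\<lambda>x. S\<^sup>2 / 2 * f x) \<longlongrightarrow> 0) (at 0 within {0..})"
      by (simp add: f_0)
    have "\<forall>\<^sub>F x in at 0 within {0..}. norm (surface_weight \<tau> x) \<le> S\<^sup>2 / 2 * f x"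
      unfolding eventually_at using bound by (intro exI[of _ 1]) (auto simp: dist_norm)
    from Lim_null_comparison[OF this lim] have "(surface_weight \<tau> \<longlongrightarrow> 0) (at 0 within {0..})" .
    then show ?thesis
      using 2 by (simp add: continuous_within surface_weight_def f_0)
  qed
qed

lemma tendsto_surface_weight:
  assumes x: "0 < x"
  shows "((\<lambda>\<tau>. surface_weight \<tau> x) \<longlongrightarrow> f x / (2 * sqrt (1 + (f' x)\<^sup>2))) (at_right 0)"
proof -
  have fx: "0 < f x" using x by (rule f_pos)
  have "((\<lambda>\<tau>. surface_weight \<tau> x) \<longlongrightarrow> f x ^ 3 * 1 / (4 * ((f x)\<^sup>2 / 2) * sqrt (1 + (f' x)\<^sup>2))) (at_right 0)"
    unfolding surface_weight_def using x fx sqrt_slope_nz[of x]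
    by (intro tendsto_intros tendsto_M_tau tendsto_stretch) auto
  also have "f x ^ 3 * 1 / (4 * ((f x)\<^sup>2 / 2) * sqrt (1 + (f' x)\<^sup>2)) = f x / (2 * sqrt (1 + (f' x)\<^sup>2))"
    using fx by (simp add: power2_eq_square power3_eq_cube)
  finally show ?thesis .
qed

lemma RN_version_rho_scaled:
  assumes "0 < \<tau>" "0 < rho_inf"
  shows "RN_version (mu_bar f f') (rho_scaled rho_inf \<tau> f f') (Omega3 f) (Gamma3 f)
           (layer_density f \<tau> (surface_weight \<tau>))"
  unfolding rho_scaled_def rho_scaled_as_def
proof (rule RN_version_layer_density)
  fix x :: real assume "0 \<le> x"
  have "w_rho_A rho_inf \<tau> f f' x / (\<tau> * rho_inf) = f x ^ 3 / (4 * M_tau \<tau> f f' x)"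
    using assms by (simp add: w_rho_A_def)
  then show "w_rho_A rho_inf \<tau> f f' x / (\<tau> * rho_inf) * f x * sqrt (1 + \<tau>\<^sup>2 * (f' x)\<^sup>2)
      = surface_weight \<tau> x * (f x * sqrt (1 + (f' x)\<^sup>2))"
    using sqrt_slope_nz[of x] by (simp add: surface_weight_def stretch_def)
qed (use assms in \<open>auto intro: f_cont f'_cont continuous_on_surface_weight f_nonneg surface_weight_nonneg\<close>)

lemma RN_version_rho_B:
  "RN_version (mu_bar f f') (rho_B f f') (Omega3 f) (Gamma3 f)
     (layer_density f 1 (\<lambda>x. f x / (2 * sqrt (1 + (f' x)\<^sup>2))))"
proof -
  let ?a = "\<lambda>x. f x * (f x / (2 * sqrt (1 + (f' x)\<^sup>2))) * sqrt (1 + (f' x)\<^sup>2)"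
  have "rho_B f f' = axisym (scale_measure (ennreal 1)
      (plus_measure (restr_measure L2_as (Omega_as f)) (curve_measure f ?a)))"
    by (simp add: rho_B_def rho_B_as_def circ_dirac_def scale_measure_1)
  moreover have "RN_version (mu_bar f f') (axisym (scale_measure (ennreal 1)
      (plus_measure (restr_measure L2_as (Omega_as f)) (curve_measure f ?a)))) (Omega3 f) (Gamma3 f)
      (layer_density f 1 (\<lambda>x. f x / (2 * sqrt (1 + (f' x)\<^sup>2))))"
  proof (rule RN_version_layer_density)
    show "continuous_on {0..} (\<lambda>x. f x / (2 * sqrt (1 + (f' x)\<^sup>2)))"
      by (intro continuous_intros) (auto simp: sqrt_slope_nz simp del: real_sqrt_eq_zero_cancel_iff)
  qed (auto intro: f_cont f'_cont f_nonneg divide_nonneg_nonneg mult_nonneg_nonneg)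
  ultimately show ?thesis by simp
qed

lemma layer_density_asymp:
  assumes p: "p \<in> (Omega3 f \<union> Gamma3 f) - {(0, 0, 0)}"
  shows "(\<lambda>\<tau>. layer_density f \<tau> (surface_weight \<tau>) p
            - \<tau> * layer_density f 1 (\<lambda>x. f x / (2 * sqrt (1 + (f' x)\<^sup>2))) p) \<in> o[at_right 0](\<lambda>\<tau>. \<tau>)"
proof -
  obtain x y z where pq: "p = (x, y, z)" by (cases p)
  note pt = physical_point[OF p[unfolded pq] zero_less_one]
  let ?h = "f x / (2 * sqrt (1 + (f' x)\<^sup>2))"
  show ?thesis
  proof (cases "(x, y, z) \<in> Gamma3 f")
    case True
    have "((\<lambda>\<tau>. surface_weight \<tau> x - ?h) \<longlongrightarrow> 0) (at_right 0)"
      using tendsto_surface_weight[OF pt(7)[OF True]] LIM_zero by blast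
    moreover have "\<forall>\<^sub>F \<tau> in at_right 0. (\<tau> * surface_weight \<tau> x - \<tau> * ?h) / \<tau> = surface_weight \<tau> x - ?h"
      using eventually_at_right_less[of "0::real"]
      by eventually_elim (simp add: diff_divide_distrib)
    ultimately have "((\<lambda>\<tau>. (\<tau> * surface_weight \<tau> x - \<tau> * ?h) / \<tau>) \<longlongrightarrow> 0) (at_right 0)"
      by (simp only: tendsto_cong)
    then have "(\<lambda>\<tau>. \<tau> * surface_weight \<tau> x - \<tau> * ?h) \<in> o[at_right 0](\<lambda>\<tau>. \<tau>)"
      by (rule smalloI_tendsto) (auto simp: eventually_at_right_less eventually_at intro: exI[of _ 1])
    then show ?thesis using True by (simp add: pq layer_density_Gamma3)
  next
    case False
    then show ?thesis using pt(6) by (simp add: pq layer_density_Omega3)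
  qed
qed

subsection \<open>The pressure coefficient on the body\<close>

lemma slope_powr_nz: "(1 + \<tau>\<^sup>2 * (f' x)\<^sup>2) powr (3 / 2) \<noteq> 0"
  by (simp add: add_nonneg_eq_0_iff)

lemma tendsto_slope_powr: "((\<lambda>\<tau>. (1 + \<tau>\<^sup>2 * (f' x)\<^sup>2) powr (3 / 2)) \<longlongrightarrow> 1) (at_right 0)"
proof -
  have "((\<lambda>\<tau>. (1 + \<tau>\<^sup>2 * (f' x)\<^sup>2) powr (3 / 2)) \<longlongrightarrow> (1 + 0\<^sup>2 * (f' x)\<^sup>2) powr (3 / 2)) (at_right 0)"
    by (intro tendsto_intros) auto
  then show ?thesis by simp
qed

lemma tendsto_M_tau_over_f: "((\<lambda>x. M_tau \<tau> f f' x / f x) \<longlongrightarrow> 0) (at_right 0)"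
proof (rule Lim_null_comparison)
  show "\<forall>\<^sub>F x in at_right 0. norm (M_tau \<tau> f f' x / f x) \<le> f x / 2"
    using eventually_at_right_less[of "0::real"]
  proof eventually_elim
    case (elim x)
    then have "M_tau \<tau> f f' x / f x \<le> (f x)\<^sup>2 / 2 / f x"
      using f_pos[OF elim] M_tau_le[of x \<tau>] by (intro divide_right_mono) auto
    then show ?case
      using elim f_pos[OF elim] M_tau_nonneg[of x \<tau>] by (simp add: power2_eq_square)
  qed
  have "(f \<longlongrightarrow> f 0) (at_right 0)"
    using f_cont by (auto simp: continuous_on_def intro: tendsto_within_subset)
  then show "((\<lambda>x. f x / 2) \<longlongrightarrow> 0) (at_right 0)"
    using tendsto_divide_zero[of f "at_right 0" 2] by (simp add: f_0)
qed

lemma w_p_A_formula_pos: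
  assumes "0 < x"
  shows "w_p_A_formula \<gamma> K rho_inf u_inf \<tau> f f' f'' x = rho_inf * u_inf\<^sup>2 * \<tau>\<^sup>2 * (1 / (\<gamma> * K\<^sup>2)
     + (f'' x * (M_tau \<tau> f f' x / f x) + stretch \<tau> x * (f' x)\<^sup>2) / (1 + \<tau>\<^sup>2 * (f' x)\<^sup>2) powr (3 / 2))"
proof -
  have "(f'' x * M_tau \<tau> f f' x + stretch \<tau> x * f x * (f' x)\<^sup>2) / (f x * (1 + \<tau>\<^sup>2 * (f' x)\<^sup>2) powr (3 / 2))
      = (f'' x * (M_tau \<tau> f f' x / f x) + stretch \<tau> x * (f' x)\<^sup>2) / (1 + \<tau>\<^sup>2 * (f' x)\<^sup>2) powr (3 / 2)"
    using f_pos[OF assms] slope_powr_nz[of \<tau> x] by (simp add: divide_simps)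
  then show ?thesis by (simp add: w_p_A_formula_def stretch_def)
qed

text \<open>
  The value at the vertex is the limit \<open>x \<rightarrow> 0\<close>, in which the term with \<open>M_tau\<close> vanishes, because
  \<open>M_tau / f\<close> is at most \<open>f / 2\<close>.
\<close>

lemma w_p_A_0:
  "w_p_A \<gamma> K rho_inf u_inf \<tau> f f' f'' 0 = rho_inf * u_inf\<^sup>2 * \<tau>\<^sup>2 * (1 / (\<gamma> * K\<^sup>2)
     + stretch \<tau> 0 * (f' 0)\<^sup>2 / (1 + \<tau>\<^sup>2 * (f' 0)\<^sup>2) powr (3 / 2))"
proof -
  have lims: "(f' \<longlongrightarrow> f' 0) (at_right 0)" "(f'' \<longlongrightarrow> f'' 0) (at_right 0)" "(stretch \<tau> \<longlongrightarrow> stretch \<tau> 0) (at_right 0)"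
    using f'_cont f''_cont continuous_on_stretch[of "{0..}" \<tau>]
    by (auto simp: continuous_on_def intro: tendsto_within_subset)
  have "((\<lambda>x. rho_inf * u_inf\<^sup>2 * \<tau>\<^sup>2 * (1 / (\<gamma> * K\<^sup>2)
        + (f'' x * (M_tau \<tau> f f' x / f x) + stretch \<tau> x * (f' x)\<^sup>2) / (1 + \<tau>\<^sup>2 * (f' x)\<^sup>2) powr (3 / 2)))
     \<longlongrightarrow> rho_inf * u_inf\<^sup>2 * \<tau>\<^sup>2 * (1 / (\<gamma> * K\<^sup>2)
        + (f'' 0 * 0 + stretch \<tau> 0 * (f' 0)\<^sup>2) / (1 + \<tau>\<^sup>2 * (f' 0)\<^sup>2) powr (3 / 2))) (at_right 0)"
    using slope_powr_nz[of \<tau> 0]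
    by (intro tendsto_intros lims tendsto_M_tau_over_f) (auto simp: add_nonneg_eq_0_iff)
  moreover have "\<forall>\<^sub>F x in at_right 0. rho_inf * u_inf\<^sup>2 * \<tau>\<^sup>2 * (1 / (\<gamma> * K\<^sup>2)
        + (f'' x * (M_tau \<tau> f f' x / f x) + stretch \<tau> x * (f' x)\<^sup>2) / (1 + \<tau>\<^sup>2 * (f' x)\<^sup>2) powr (3 / 2))
      = w_p_A_formula \<gamma> K rho_inf u_inf \<tau> f f' f'' x"
    using eventually_at_right_less[of "0::real"] by eventually_elim (simp only: w_p_A_formula_pos)
  ultimately have "(w_p_A_formula \<gamma> K rho_inf u_inf \<tau> f f' f'' \<longlongrightarrow> rho_inf * u_inf\<^sup>2 * \<tau>\<^sup>2 * (1 / (\<gamma> * K\<^sup>2)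
        + (f'' 0 * 0 + stretch \<tau> 0 * (f' 0)\<^sup>2) / (1 + \<tau>\<^sup>2 * (f' 0)\<^sup>2) powr (3 / 2))) (at_right 0)"
    by (rule Lim_transform_eventually)
  then have "Lim (at_right 0) (w_p_A_formula \<gamma> K rho_inf u_inf \<tau> f f' f'')
      = rho_inf * u_inf\<^sup>2 * \<tau>\<^sup>2 * (1 / (\<gamma> * K\<^sup>2)
        + (f'' 0 * 0 + stretch \<tau> 0 * (f' 0)\<^sup>2) / (1 + \<tau>\<^sup>2 * (f' 0)\<^sup>2) powr (3 / 2))"
    by (intro tendsto_Lim) auto
  then show ?thesis by (simp add: w_p_A_def)
qed

lemma w_p_scaled_asymp:
  assumes pos: "0 < \<gamma>" "0 < K" "0 < rho_inf" "0 < u_inf" and x: "0 \<le> x"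
  shows "(\<lambda>\<tau>. w_p_scaled \<gamma> K rho_inf u_inf \<tau> f f' f'' x - w_p_B \<gamma> K f f' f'' x) \<in> o[at_right 0](\<lambda>_. 1)"
proof (rule smallo_1I)
  \<comment> \<open>At \<open>x = 0\<close> the quotient \<open>M_tau / f\<close> reads \<open>0 / 0 = 0\<close>, its limit at the vertex.\<close>
  let ?w = "\<lambda>\<tau>. 1 / (\<gamma> * K\<^sup>2) + (f'' x * (M_tau \<tau> f f' x / f x) + stretch \<tau> x * (f' x)\<^sup>2)
                / (1 + \<tau>\<^sup>2 * (f' x)\<^sup>2) powr (3 / 2)"
  have A: "w_p_A \<gamma> K rho_inf u_inf \<tau> f f' f'' x = rho_inf * u_inf\<^sup>2 * \<tau>\<^sup>2 * ?w \<tau>" for \<tau>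
  proof (cases "x = 0")
    case False
    with x show ?thesis using w_p_A_formula_pos[of x] by (simp add: w_p_A_def)
  qed (simp add: w_p_A_0 f_0)
  have M: "((\<lambda>\<tau>. M_tau \<tau> f f' x / f x) \<longlongrightarrow> f x / 2) (at_right 0)"
  proof (cases "x = 0")
    case False
    with x have f: "f x \<noteq> 0" using f_pos[of x] by simp
    have "((\<lambda>\<tau>. M_tau \<tau> f f' x / f x) \<longlongrightarrow> (f x)\<^sup>2 / 2 / f x) (at_right 0)"
      using x f by (intro tendsto_intros tendsto_M_tau)
    then show ?thesis using f by (simp add: power2_eq_square)
  qed (simp add: f_0)
  have "(?w \<longlongrightarrow> 1 / (\<gamma> * K\<^sup>2) + (f'' x * (f x / 2) + 1 * (f' x)\<^sup>2) / 1) (at_right 0)"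
    by (intro tendsto_intros M tendsto_stretch tendsto_slope_powr) simp
  then show "(?w \<longlongrightarrow> w_p_B \<gamma> K f f' f'' x) (at_right 0)"
    by (simp add: w_p_B_def p_bar_inf_def algebra_simps)
  show "\<forall>\<^sub>F \<tau> in at_right 0. w_p_scaled \<gamma> K rho_inf u_inf \<tau> f f' f'' x - w_p_B \<gamma> K f f' f'' x
      = ?w \<tau> - w_p_B \<gamma> K f f' f'' x"
    using eventually_at_right_less[of "0::real"]
  proof eventually_elim
    case (elim \<tau>)
    have "\<gamma> * p_inf \<gamma> K rho_inf u_inf \<tau> * K\<^sup>2 = rho_inf * u_inf\<^sup>2 * \<tau>\<^sup>2"
      using pos by (simp add: p_inf_def)
    then show ?case
      unfolding w_p_scaled_def A using pos elim by simp
  qed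
qed

end


section \<open>The hypersonic similarity law\<close>

theorem theorem4p1:
  fixes \<gamma> K rho_inf u_inf :: real and f f' f'' :: "real \<Rightarrow> real"
  assumes "\<gamma> > 1" and "K > 0" and "rho_inf > 0" and "u_inf > 0"
    and "\<forall>x\<ge>0. (f has_real_derivative f' x) (at x within {0..})"
    and "\<forall>x\<ge>0. (f' has_real_derivative f'' x) (at x within {0..})"
    and "continuous_on {0..} f''"
    and "f 0 = 0"
    and "\<forall>x\<ge>0. f' x > 0"
    and "\<forall>x>0. 2 * f x + \<gamma> * K\<^sup>2 * (2 * f x * (f' x)\<^sup>2 + (f x)\<^sup>2 * f'' x) > 0"
    and "\<forall>\<^sub>F \<tau> in at_right 0. \<forall>x\<ge>0.
           f x * (1 + \<tau>\<^sup>2 * (f' x)\<^sup>2) powr (3 / 2)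
           + \<gamma> * K\<^sup>2 * (f'' x * M_tau \<tau> f f' x + sqrt (1 + \<tau>\<^sup>2 * (f' x)\<^sup>2) * f x * (f' x)\<^sup>2) \<ge> 0"
  shows "(\<forall>p \<in> (Omega3 f \<union> Gamma3 f) - {(0, 0, 0)}.
           (\<lambda>\<tau>. u_scaled u_inf \<tau> f f' p - u_B f f' f'' p) \<in> o[at_right 0](\<lambda>_. 1) \<and>
           (\<lambda>\<tau>. v_scaled u_inf \<tau> f f' p - v_B f f' p) \<in> o[at_right 0](\<lambda>_. 1) \<and>
           (\<lambda>\<tau>. w_scaled u_inf \<tau> f f' p - w_B f f' p) \<in> o[at_right 0](\<lambda>_. 1) \<and>
           (\<lambda>\<tau>. E_scaled \<gamma> K u_inf \<tau> f p - E_B \<gamma> K f p) \<in> o[at_right 0](\<lambda>_. 1)) \<and>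
         (\<exists>H h.
           (\<forall>\<^sub>F \<tau> in at_right 0.
              RN_version (mu_bar f f') (rho_scaled rho_inf \<tau> f f') (Omega3 f) (Gamma3 f) (H \<tau>)) \<and>
           RN_version (mu_bar f f') (rho_B f f') (Omega3 f) (Gamma3 f) h \<and>
           (\<forall>p \<in> (Omega3 f \<union> Gamma3 f) - {(0, 0, 0)}.
              (\<lambda>\<tau>. H \<tau> p - \<tau> * h p) \<in> o[at_right 0](\<lambda>\<tau>. \<tau>))) \<and>
         (\<forall>x\<ge>0. (\<lambda>\<tau>. w_p_scaled \<gamma> K rho_inf u_inf \<tau> f f' f'' x - w_p_B \<gamma> K f f' f'' x) \<in> o[at_right 0](\<lambda>_. 1))"
proof -
  interpret body_profile f f' f''
    using assms(5-9) by unfold_locales auto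
  let ?H = "\<lambda>\<tau>. layer_density f \<tau> (surface_weight \<tau>)"
  let ?h = "layer_density f 1 (\<lambda>x. f x / (2 * sqrt (1 + (f' x)\<^sup>2)))"
  have v: "(\<lambda>\<tau>. v_scaled u_inf \<tau> f f' p - v_B f f' p) \<in> o[at_right 0](\<lambda>_. 1)"
    and w: "(\<lambda>\<tau>. w_scaled u_inf \<tau> f f' p - w_B f f' p) \<in> o[at_right 0](\<lambda>_. 1)"
    if p: "p \<in> (Omega3 f \<union> Gamma3 f) - {(0, 0, 0)}" for p
  proof -
    obtain x y z where pq: "p = (x, y, z)" by (cases p)
    from q_scaled_asymp[OF \<open>u_inf > 0\<close> p[unfolded pq]]
    show "(\<lambda>\<tau>. v_scaled u_inf \<tau> f f' p - v_B f f' p) \<in> o[at_right 0](\<lambda>_. 1)"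
      "(\<lambda>\<tau>. w_scaled u_inf \<tau> f f' p - w_B f f' p) \<in> o[at_right 0](\<lambda>_. 1)"
      by (simp_all only: pq v_scaled_def v_B_def w_scaled_def w_B_def prod.case)
  qed
  have "\<forall>\<^sub>F \<tau> in at_right 0.
      RN_version (mu_bar f f') (rho_scaled rho_inf \<tau> f f') (Omega3 f) (Gamma3 f) (?H \<tau>)"
    using eventually_at_right_less[of "0::real"]
    by eventually_elim (rule RN_version_rho_scaled[OF _ \<open>rho_inf > 0\<close>])
  moreover note RN_version_rho_B layer_density_asymp
  ultimately have "\<exists>H h.
      (\<forall>\<^sub>F \<tau> in at_right 0.
         RN_version (mu_bar f f') (rho_scaled rho_inf \<tau> f f') (Omega3 f) (Gamma3 f) (H \<tau>)) \<and>
      RN_version (mu_bar f f') (rho_B f f') (Omega3 f) (Gamma3 f) h \<and>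
      (\<forall>p \<in> (Omega3 f \<union> Gamma3 f) - {(0, 0, 0)}.
         (\<lambda>\<tau>. H \<tau> p - \<tau> * h p) \<in> o[at_right 0](\<lambda>\<tau>. \<tau>))"
    by (intro exI[of _ ?H] exI[of _ ?h] conjI ballI)
  then show ?thesis
    using u_scaled_asymp[OF \<open>u_inf > 0\<close>] v w E_scaled_asymp[OF \<open>u_inf > 0\<close>] assms(1-4)
    by (auto intro!: w_p_scaled_asymp simp del: Un_iff Diff_iff)
qed

end
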